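(* Let $H=(\sigma,\alpha)$ be a hypermap on $\{1,2,\ldots,n\}$ such that $(1,2,3)$ is a cycle of $\alpha$. Let $\alpha'=\alpha(1,3,2)$ be the permutation obtained by replacing the cycle $(1,2,3)$ of $\alpha$ with $(1)(2)(3)$. Write $R(\sigma,\alpha)$ for the Whitney polynomial $R(\sigma,\alpha;u,v)$. Then the following hold. (1) If $(1,2,3)$ is a double loop then $R(\sigma,\alpha)=(1+3v+v^2)\cdot R(\sigma,\alpha')$. (2) If $(1,2,3)$ is a double bridge then $R(\sigma,\alpha)=(1+3u+u^2)\cdot R((1,2)(1,3)\sigma,\alpha')$. (3) If $(1,2,3)$ is a simple loop where $1$ and $2$ belong to the same cycle of $\sigma$ then $$R(\sigma,\alpha)=(1+v)\cdot\left(R((2,3)\sigma,\alpha')+R(\sigma,\alpha')\right)+R((1,3)\sigma,\alpha').$$ (4) If $(1,2,3)$ is a simple bridge where $\kappa(\sigma,\alpha(2,3))=\kappa(\sigma,\alpha)+1$ then $$R(\sigma,\alpha)=(1+u)\cdot\left(R((2,3)\sigma,\alpha')+R((1,2)(1,3)\sigma,\alpha')\right)+R((1,3)\sigma,\alpha').$$ (5) If $(1,2,3)$ is a bridge-loop where $1$ and $2$ belong to the same cycle of $\sigma$ then $$R(\sigma,\alpha)=(1+u)\cdot(1+v)\cdot R((2,3)\sigma,\alpha')+R((1,3)\sigma,\alpha').$$ (6) If $(1,2,3)$ is an ordinary regular hyperedge then $$R(\sigma,\alpha)=R(\sigma,\alpha')+R((2,3)\sigma,\alpha')+R((1,2)\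sigma,\alpha')+R((1,2)(1,3)\sigma,\alpha')+R((1,3)\sigma,\alpha').$$
   Context: Permutations are composed from right to left, so e.g. $(1,2,3)(1,3)=(2,3)$. A collection of hypermaps is a pair $(\sigma,\alpha)$ of permutations of $\{1,\ldots,n\}$; $\kappa(\sigma,\alpha)$ is the number of orbits of the group $\langle\sigma,\alpha\rangle$ (connected components). It is a hypermap if $\kappa(\sigma,\alpha)=1$. The cycles of $\sigma$ are the vertices, the cycles of $\alpha$ are the hyperedges (fixed points count as cycles). $z(\pi)$ is the number of cycles of $\pi$, fixed points included. Refinement: a permutation $\beta$ refines $\alpha$, written $\beta\le\alpha$, if for each cycle $\gamma$ of $\alpha$, $\beta$ maps the set of points of $\gamma$ to itself and, with $\theta$ the restriction of $\beta$ to this set of $m$ points, $m+2=z(\theta)+z(\gamma)+z(\gamma^{-1}\theta)$, i.e. $(\theta,\gamma)$ has genus zero; equivalently, the cycles of $\theta$ form a noncrossing partition with respect to the cyclic order of $\gamma$, each cycle of $\theta$ listing its points in the cyclic order induced by $\gamma$. The Whitney polynomial of a collection of hypermaps $(\sigma,\alpha)$ on $n$ points is $$R(\sigma,\alpha;u,v)=\sum_{\beta\le\alpha}u^{\kappa(\sigma,\beta)-\kappa(\sigma,\alpha)}\,v^{\kappa(\sigma,\beta)+n-z(\beta)-z(\sigma)}.$$ Classification of a $3$-cycle $(i,j,k)$ of $\alpha$: it is a double loop if $i,j,k$ all belong to the same cycle of $\sigma$; a single loop if exactly two of $i,j,k$ belong to the same cycle of $\sigma$; regular if $i,j,k$ belong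 to three distinct cycles of $\sigma$. The permutation $\alpha(i,k,j)$ is obtained by replacing $(i,j,k)$ with $(i)(j)(k)$; the $3$-cycle is a double bridge, a single bridge, or ordinary if $\kappa(\sigma,\alpha(i,k,j))-\kappa(\sigma,\alpha)$ equals $2$, $1$, or $0$, respectively. An ordinary regular hyperedge is one that is both ordinary and regular; a simple loop is a single loop that is ordinary; a simple bridge is a single bridge that is regular; a bridge-loop is a single bridge that is also a single loop. *)

theory Defs
  imports
    "HOL-Combinatorics.Orbits"
    "HOL-Combinatorics.Cycles"
    "HOL-Algebra.Sym_Groups"
    "HOL-Algebra.Group_Action"
    "HOL-Computational_Algebra.Polynomial"
begin

text \<open>
  Permutations of \<open>{1..n}\<close> are functions on \<open>nat\<close> that fix every point outside \<open>{1..n}\<close>;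
  products are read from right to left, so the product of two permutations is their
  composition \<open>\<circ>\<close>.
\<close>

text \<open>\<open>z A \<pi>\<close> is meant for \<open>\<pi>\<close> mapping the finite set \<open>A\<close> bijectively to itself; a fixed
  point in \<open>A\<close> contributes its own one-element orbit.\<close>

definition z :: "nat set \<Rightarrow> (nat \<Rightarrow> nat) \<Rightarrow> nat" where
  "z A \<pi> = card (Orbits.orbit \<pi> ` A)"

definition \<kappa> :: "nat \<Rightarrow> (nat \<Rightarrow> nat) \<Rightarrow> (nat \<Rightarrow> nat) \<Rightarrow> nat" where
  "\<kappa> n \<sigma> \<alpha> =
     card (orbits ((sym_group n)\<lparr>carrier := generate (sym_group n) {\<sigma>, \<alpha>}\<rparr>) {1..n} (\<lambda>g. g))"

definition hypermap_collection :: "nat \<Rightarrow> (nat \<Rightarrow> nat) \<Rightarrow> (nat \<Rightarrow> nat) \<Rightarrow> bool" where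
  "hypermap_collection n \<sigma> \<alpha> \<longleftrightarrow> \<sigma> permutes {1..n} \<and> \<alpha> permutes {1..n}"

definition hypermap :: "nat \<Rightarrow> (nat \<Rightarrow> nat) \<Rightarrow> (nat \<Rightarrow> nat) \<Rightarrow> bool" where
  "hypermap n \<sigma> \<alpha> \<longleftrightarrow> hypermap_collection n \<sigma> \<alpha> \<and> \<kappa> n \<sigma> \<alpha> = 1"

text \<open>The cycles \<open>\<gamma>\<close> of \<open>\<alpha>\<close> are represented by their sets \<open>C\<close> of points, on which \<open>\<gamma>\<close>
  is the restriction of \<open>\<alpha>\<close>.\<close>

definition refines :: "nat \<Rightarrow> (nat \<Rightarrow> nat) \<Rightarrow> (nat \<Rightarrow> nat) \<Rightarrow> bool" where
  "refines n \<beta> \<alpha> \<longleftrightarrow> \<beta> permutes {1..n} \<and>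
     (\<forall>C \<in> Orbits.orbit \<alpha> ` {1..n}.
        let \<gamma> = perm_restrict \<alpha> C; \<theta> = perm_restrict \<beta> C in
          \<beta> ` C = C \<and> card C + 2 = z C \<theta> + z C \<gamma> + z C (inv' \<gamma> \<circ> \<theta>))"

text \<open>Polynomials in two indeterminates with integer coefficients are polynomials in
  \<open>var_v\<close> over the polynomials in \<open>var_u\<close>.\<close>

definition var_u :: "int poly poly" where
  "var_u = [:[:0, 1:]:]"

definition var_v :: "int poly poly" where
  "var_v = [:0, 1:]"

text \<open>Both exponents are nonnegative, so truncated subtraction does no harm: the orbits of
  \<open>\<sigma>\<close> and \<open>\<beta> \<le> \<alpha>\<close> are contained in those of \<open>\<sigma>\<close> and \<open>\<alpha>\<close>, and the bipartite graph with
  the cycles of \<open>\<sigma>\<close> and of \<open>\<beta>\<close> as its \<open>z(\<sigma>) + z(\<beta>)\<close> nodes and the points as its \<open>n\<close> edges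
  has \<open>\<kappa>(\<sigma>,\<beta>)\<close> components.\<close>

definition whitney :: "nat \<Rightarrow> (nat \<Rightarrow> nat) \<Rightarrow> (nat \<Rightarrow> nat) \<Rightarrow> int poly poly" where
  "whitney n \<sigma> \<alpha> =
     (\<Sum>\<beta> | refines n \<beta> \<alpha>.
        var_u ^ (\<kappa> n \<sigma> \<beta> - \<kappa> n \<sigma> \<alpha>) *
        var_v ^ (\<kappa> n \<sigma> \<beta> + n - z {1..n} \<beta> - z {1..n} \<sigma>))"

definition is_three_cycle :: "(nat \<Rightarrow> nat) \<Rightarrow> nat \<Rightarrow> nat \<Rightarrow> nat \<Rightarrow> bool" where
  "is_three_cycle \<alpha> i j k \<longleftrightarrow> distinct [i, j, k] \<and> \<alpha> i = j \<and> \<alpha> j = k \<and> \<alpha> k = i"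

definition same_cycle :: "(nat \<Rightarrow> nat) \<Rightarrow> nat \<Rightarrow> nat \<Rightarrow> bool" where
  "same_cycle \<sigma> i j \<longleftrightarrow> Orbits.orbit \<sigma> i = Orbits.orbit \<sigma> j"

text \<open>In the classification below, \<open>(i,j,k)\<close> is assumed to be a 3-cycle of \<open>\<alpha>\<close>.\<close>

definition double_loop :: "(nat \<Rightarrow> nat) \<Rightarrow> nat \<Rightarrow> nat \<Rightarrow> nat \<Rightarrow> bool" where
  "double_loop \<sigma> i j k \<longleftrightarrow> same_cycle \<sigma> i j \<and> same_cycle \<sigma> j k"

definition single_loop :: "(nat \<Rightarrow> nat) \<Rightarrow> nat \<Rightarrow> nat \<Rightarrow> nat \<Rightarrow> bool" where
  "single_loop \<sigma> i j k \<longleftrightarrow>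
     (same_cycle \<sigma> i j \<and> \<not> same_cycle \<sigma> i k) \<or>
     (same_cycle \<sigma> j k \<and> \<not> same_cycle \<sigma> j i) \<or>
     (same_cycle \<sigma> i k \<and> \<not> same_cycle \<sigma> i j)"

definition regular :: "(nat \<Rightarrow> nat) \<Rightarrow> nat \<Rightarrow> nat \<Rightarrow> nat \<Rightarrow> bool" where
  "regular \<sigma> i j k \<longleftrightarrow>
     \<not> same_cycle \<sigma> i j \<and> \<not> same_cycle \<sigma> j k \<and> \<not> same_cycle \<sigma> i k"

definition split_cycle :: "(nat \<Rightarrow> nat) \<Rightarrow> nat \<Rightarrow> nat \<Rightarrow> nat \<Rightarrow> nat \<Rightarrow> nat" where
  "split_cycle \<alpha> i j k = \<alpha> \<circ> cycle_of_list [i, k, j]"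

definition double_bridge ::
  "nat \<Rightarrow> (nat \<Rightarrow> nat) \<Rightarrow> (nat \<Rightarrow> nat) \<Rightarrow> nat \<Rightarrow> nat \<Rightarrow> nat \<Rightarrow> bool" where
  "double_bridge n \<sigma> \<alpha> i j k \<longleftrightarrow> \<kappa> n \<sigma> (split_cycle \<alpha> i j k) = \<kappa> n \<sigma> \<alpha> + 2"

definition single_bridge ::
  "nat \<Rightarrow> (nat \<Rightarrow> nat) \<Rightarrow> (nat \<Rightarrow> nat) \<Rightarrow> nat \<Rightarrow> nat \<Rightarrow> nat \<Rightarrow> bool" where
  "single_bridge n \<sigma> \<alpha> i j k \<longleftrightarrow> \<kappa> n \<sigma> (split_cycle \<alpha> i j k) = \<kappa> n \<sigma> \<alpha> + 1"

definition ordinary ::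
  "nat \<Rightarrow> (nat \<Rightarrow> nat) \<Rightarrow> (nat \<Rightarrow> nat) \<Rightarrow> nat \<Rightarrow> nat \<Rightarrow> nat \<Rightarrow> bool" where
  "ordinary n \<sigma> \<alpha> i j k \<longleftrightarrow> \<kappa> n \<sigma> (split_cycle \<alpha> i j k) = \<kappa> n \<sigma> \<alpha>"

definition ordinary_regular ::
  "nat \<Rightarrow> (nat \<Rightarrow> nat) \<Rightarrow> (nat \<Rightarrow> nat) \<Rightarrow> nat \<Rightarrow> nat \<Rightarrow> nat \<Rightarrow> bool" where
  "ordinary_regular n \<sigma> \<alpha> i j k \<longleftrightarrow> ordinary n \<sigma> \<alpha> i j k \<and> regular \<sigma> i j k"

definition simple_loop ::
  "nat \<Rightarrow> (nat \<Rightarrow> nat) \<Rightarrow> (nat \<Rightarrow> nat) \<Rightarrow> nat \<Rightarrow> nat \<Rightarrow> nat \<Rightarrow> bool" where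
  "simple_loop n \<sigma> \<alpha> i j k \<longleftrightarrow> single_loop \<sigma> i j k \<and> ordinary n \<sigma> \<alpha> i j k"

definition simple_bridge ::
  "nat \<Rightarrow> (nat \<Rightarrow> nat) \<Rightarrow> (nat \<Rightarrow> nat) \<Rightarrow> nat \<Rightarrow> nat \<Rightarrow> nat \<Rightarrow> bool" where
  "simple_bridge n \<sigma> \<alpha> i j k \<longleftrightarrow> single_bridge n \<sigma> \<alpha> i j k \<and> regular \<sigma> i j k"

definition bridge_loop ::
  "nat \<Rightarrow> (nat \<Rightarrow> nat) \<Rightarrow> (nat \<Rightarrow> nat) \<Rightarrow> nat \<Rightarrow> nat \<Rightarrow> nat \<Rightarrow> bool" where
  "bridge_loop n \<sigma> \<alpha> i j k \<longleftrightarrow> single_bridge n \<sigma> \<alpha> i j k \<and> single_loop \<sigma> i j k"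

end

theory Submission
  imports Defs
begin

text \<open>
  Write \<open>\<tau>\<close> for one of the five noncrossing permutations of the cycle \<open>(1,2,3)\<close>, namely the
  identity, the three transpositions and \<open>(1,2,3)\<close>. The refinements of \<open>\<alpha>\<close> are the products
  \<open>\<tau> \<beta>\<close> with \<open>\<beta> \<le> \<alpha>'\<close>, so \<open>R(\<sigma>,\<alpha>)\<close> splits into five sums over the refinements of \<open>\<alpha>'\<close>.
  Multiplying a permutation by a transposition \<open>(i,j)\<close> of points in distinct cycles merges these two
  cycles, hence \<open>\<kappa>(\<sigma>, (i,j)\<beta>) = \<kappa>((i,j)\<sigma>, \<beta>)\<close> whenever both products merge cycles: both sides count the
  classes of the equivalence relation generated by \<open>\<sigma>\<close>, \<open>\<beta>\<close> and \<open>(i,j)\<close>. All modified \<open>\<sigma>\<close> in the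
  theorem arise from \<open>\<sigma>\<close> by such merges, so that in each of the six cases each of the five sums equals
  \<open>u\<^sup>p v\<^sup>q\<close> times the Whitney polynomial of some modified \<open>\<sigma>\<close> and \<open>\<alpha>'\<close>, where \<open>p\<close> and \<open>q\<close> do not
  depend on \<open>\<beta>\<close>: points in one cycle of \<open>\<sigma>\<close> are connected for every \<open>\<beta>\<close>, and points that \<open>\<sigma>\<close> and
  \<open>\<alpha>'\<close> leave unconnected are connected for no \<open>\<beta> \<le> \<alpha>'\<close>.
\<close>

section \<open>Classes of a generated equivalence relation\<close>

declare One_nat_def [simp del] \<comment> \<open>would turn \<open>{1..n}\<close> into \<open>{Suc 0..n}\<close>\<close>

text \<open>Taken over the whole type: a point without edges forms a class of its own, so no carrier
  set has to accompany the relation.\<close>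

definition ecl :: "('a \<times> 'a) set \<Rightarrow> ('a \<times> 'a) set" where
  "ecl E = (E \<union> E\<inverse>)\<^sup>*"

lemma equiv_ecl: "equiv UNIV (ecl E)"
  unfolding ecl_def by (intro equivI refl_rtrancl trans_rtrancl sym_rtrancl sym_Un_converse) auto

lemma ecl_refl [simp]: "(x, x) \<in> ecl E"
  by (simp add: ecl_def)

lemma ecl_sym: "(x, y) \<in> ecl E \<Longrightarrow> (y, x) \<in> ecl E"
  using equiv_ecl[of E] by (meson equivE symD)

lemma ecl_commute: "(x, y) \<in> ecl E \<longleftrightarrow> (y, x) \<in> ecl E"
  using ecl_sym by metis

lemma ecl_trans: "(x, y) \<in> ecl E \<Longrightarrow> (y, w) \<in> ecl E \<Longrightarrow> (x, w) \<in> ecl E"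
  unfolding ecl_def by (rule rtrancl_trans)

lemma ecl_base: "(x, y) \<in> E \<Longrightarrow> (x, y) \<in> ecl E"
  unfolding ecl_def by auto

lemma subset_ecl: "E \<subseteq> ecl E"
  by (auto intro: ecl_base)

lemma ecl_subset:
  assumes "E \<subseteq> ecl F"
  shows "ecl E \<subseteq> ecl F"
proof -
  have "E \<union> E\<inverse> \<subseteq> ecl F" using assms by (auto intro: ecl_sym)
  hence "(E \<union> E\<inverse>)\<^sup>* \<subseteq> (ecl F)\<^sup>*" by (rule rtrancl_mono)
  thus ?thesis unfolding ecl_def by simp
qed

lemma ecl_mono: "E \<subseteq> F \<Longrightarrow> ecl E \<subseteq> ecl F"
  by (rule ecl_subset) (auto intro: ecl_base)

lemma ecl_cong: "E \<subseteq> ecl F \<Longrightarrow> F \<subseteq> ecl E \<Longrightarrow> ecl E = ecl F"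
  by (simp add: ecl_subset subset_antisym)

text \<open>Lets the graph of one permutation be exchanged for an equivalent one while the graph of
  the other stays in the union.\<close>

lemma ecl_Un_cong:
  assumes "ecl E = ecl E'" "ecl F = ecl F'"
  shows "ecl (E \<union> F) = ecl (E' \<union> F')"
proof -
  have *: "E \<union> F \<subseteq> ecl (E' \<union> F')" if "ecl E = ecl E'" "ecl F = ecl F'"
    for E F E' F' :: "('a \<times> 'a) set"
    using subset_ecl[of E] subset_ecl[of F] ecl_mono[of E' "E' \<union> F'"]
      ecl_mono[of F' "E' \<union> F'"] unfolding that by blast
  show ?thesis by (rule ecl_cong; rule *; simp add: assms)
qed

text \<open>A path that runs through the new edge repeatedly can be cut short to one that uses it at
  most once, in one of its two directions. The induction along the path carries this three-way
  alternative.\<close>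

lemma ecl_insert_iff:
  "(x, y) \<in> ecl (insert (i, j) E) \<longleftrightarrow>
     (x, y) \<in> ecl E \<or> (x, i) \<in> ecl E \<and> (j, y) \<in> ecl E \<or> (x, j) \<in> ecl E \<and> (i, y) \<in> ecl E"
    (is "?L \<longleftrightarrow> ?R x y")
proof
  assume ?L
  hence "(x, y) \<in> (insert (i, j) E \<union> (insert (i, j) E)\<inverse>)\<^sup>*" by (simp add: ecl_def)
  thus "?R x y"
  proof induction
    case (step y w)
    then consider "(y, w) \<in> ecl E" | "y = i" "w = j" | "y = j" "w = i"
      by (auto intro: ecl_base ecl_sym[OF ecl_base])
    thus ?case
    proof cases
      case 1
      thus ?thesis using step.IH ecl_trans[OF _ 1] by blast
    next
      case 2
      thus ?thesis using step.IH ecl_refl[of _ E] ecl_sym[of _ _ E] ecl_trans[of _ _ E] by metis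
    next
      case 3
      thus ?thesis using step.IH ecl_refl[of _ E] ecl_sym[of _ _ E] ecl_trans[of _ _ E] by metis
    qed
  qed simp
next
  have E: "ecl E \<subseteq> ecl (insert (i, j) E)" by (intro ecl_mono) auto
  have "(i, j) \<in> ecl (insert (i, j) E)" by (intro ecl_base) auto
  moreover assume "?R x y"
  ultimately show ?L using E by (meson ecl_sym ecl_trans subsetD)
qed

lemma ecl_class_eq_iff: "ecl E `` {x} = ecl E `` {y} \<longleftrightarrow> (x, y) \<in> ecl E"
  by (metis UNIV_I equiv_ecl eq_equiv_class_iff)

section \<open>Counting classes\<close>

definition ncomp :: "'a set \<Rightarrow> ('a \<times> 'a) set \<Rightarrow> nat" where
  "ncomp A E = card ((\<lambda>x. ecl E `` {x}) ` A)"

lemma ncomp_cong: "ecl E = ecl F \<Longrightarrow> ncomp A E = ncomp A F"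
  by (simp add: ncomp_def)

lemma ncomp_insert_same: "(i, j) \<in> ecl E \<Longrightarrow> ncomp A (insert (i, j) E) = ncomp A E"
  by (intro ncomp_cong ecl_cong) (auto intro: ecl_base)

text \<open>Classes of the larger relation are unions of classes of the smaller one, so saturating
  under \<open>ecl F\<close> maps the classes of \<open>ecl E\<close> onto those of
  \<open>ecl F\<close>.\<close>

lemma ncomp_mono:
  assumes "finite A" "ecl E \<subseteq> ecl F"
  shows "ncomp A F \<le> ncomp A E"
proof -
  have "ecl F `` {x} = ecl F `` (ecl E `` {x})" for x
    using assms(2) ecl_trans[of _ _ F] ecl_refl[of _ E] by blast
  hence "(\<lambda>x. ecl F `` {x}) ` A = (\<lambda>C. ecl F `` C) ` (\<lambda>x. ecl E `` {x}) ` A"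
    by (simp add: image_image)
  thus ?thesis unfolding ncomp_def using assms(1) by (metis card_image_le finite_imageI)
qed

text \<open>The classes of \<open>i\<close> and \<open>j\<close>, distinct by hypothesis, fuse into
  their union, and every other class stays as it is.\<close>

lemma ncomp_insert_new:
  assumes "finite A" "i \<in> A" "j \<in> A" "(i, j) \<notin> ecl E"
  shows "Suc (ncomp A (insert (i, j) E)) = ncomp A E"
proof -
  let ?c = "\<lambda>x. ecl E `` {x}" and ?d = "\<lambda>x. ecl (insert (i, j) E) `` {x}"
  have d: "?d x = (if x \<in> ?c i \<union> ?c j then ?c i \<union> ?c j else ?c x)" for x
  proof -
    have "?d x = ?c x \<union> (if (x, i) \<in> ecl E then ?c j else {}) \<union> (if (x, j) \<in> ecl E then ?c i else {})"
      by (auto simp: ecl_insert_iff)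
    moreover have "?c x = ?c i" if "(x, i) \<in> ecl E"
      using that by (simp add: ecl_class_eq_iff)
    moreover have "?c x = ?c j" if "(x, j) \<in> ecl E"
      using that by (simp add: ecl_class_eq_iff)
    moreover have "x \<in> ?c y \<longleftrightarrow> (x, y) \<in> ecl E" for y
      by (simp add: ecl_commute)
    ultimately show ?thesis by (simp add: Un_commute)
  qed
  \<comment> \<open>The classes untouched by the new edge: the old family is \<open>?B\<close> with
    two more classes, the new one is \<open>?B\<close> with the fused class.\<close>
  let ?B = "?c ` A - {?c i, ?c j}"
  have B: "?B = ?c ` {x \<in> A. x \<notin> ?c i \<union> ?c j}"
  proof -
    have "x \<notin> ?c i \<union> ?c j \<longleftrightarrow> ?c x \<notin> {?c i, ?c j}" for x
      by (simp add: ecl_class_eq_iff ecl_commute)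
    moreover have "f ` A - D = f ` {x \<in> A. f x \<notin> D}" for f :: "'a \<Rightarrow> 'a set" and D
      by auto
    ultimately show ?thesis by presburger
  qed
  have "?d ` A = insert (?d i) (?d ` {x \<in> A. x \<notin> ?c i \<union> ?c j})"
  proof -
    have "i \<in> ?c i \<union> ?c j" by simp
    hence "?d x = ?d i" if "x \<in> ?c i \<union> ?c j" for x
      using that d[of x] d[of i] by presburger
    thus ?thesis using assms(2) by blast
  qed
  also have "?d ` {x \<in> A. x \<notin> ?c i \<union> ?c j} = ?B"
    unfolding B by (intro image_cong refl) (simp add: d)
  finally have "?d ` A = insert (?d i) ?B" .
  moreover have "?d i \<notin> ?B"
  proof
    assume "?d i \<in> ?B"
    then obtain x where x: "x \<notin> ?c i \<union> ?c j" "?d i = ?c x" unfolding B by blast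
    moreover have "x \<in> ?c x" "i \<in> ?c i" by simp_all
    ultimately show False using d[of i] by (metis UnI1)
  qed
  moreover have "finite ?B" using assms(1) by auto
  ultimately have "ncomp A (insert (i, j) E) = Suc (card ?B)"
    by (simp add: ncomp_def)
  moreover have "?c i \<noteq> ?c j" using assms(4) by (simp add: ecl_class_eq_iff)
  hence "card {?c i, ?c j} = 2" by simp
  moreover have "{?c i, ?c j} \<subseteq> ?c ` A" using assms by auto
  ultimately show ?thesis
    unfolding ncomp_def using assms(1)
    by (metis (no_types, lifting) Suc_eq_plus1 add_2_eq_Suc' add_Suc card_Diff_subset card_mono
        finite.emptyI finite_imageI finite_insert le_add_diff_inverse2 numeral_2_eq_2)
qed

lemma ncomp_insert:
  assumes "finite A" "i \<in> A" "j \<in> A"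
  shows "ncomp A (insert (i, j) E) + (if (i, j) \<in> ecl E then 0 else 1) = ncomp A E"
  using ncomp_insert_new[OF assms, of E] ncomp_insert_same[of i j E A] by auto

lemma ncomp_empty: "ncomp A {} = card A"
proof -
  have "inj (\<lambda>x. ecl {} `` {x :: 'a})" by (auto simp: ecl_def inj_def)
  thus ?thesis by (simp add: ncomp_def card_image inj_on_subset)
qed

text \<open>Insert the edges of \<open>F\<close> one at a time, starting from equality. An edge that
  lowers the count for \<open>E \<union> F\<close> joins points not yet connected there, hence not
  connected by \<open>F\<close> alone either, so the left side falls whenever the right side
  does.\<close>

lemma ncomp_Un_ge:
  assumes "finite A" "finite F" "F \<subseteq> A \<times> A"
  shows "ncomp A E + ncomp A F \<le> ncomp A (E \<union> F) + card A"
  using assms(2,3)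
proof (induction F)
  case empty
  show ?case by (simp add: ncomp_empty)
next
  case (insert p F)
  obtain i j where p: "p = (i, j)" "i \<in> A" "j \<in> A" using insert.prems by auto
  have "(i, j) \<in> ecl (E \<union> F)" if "(i, j) \<in> ecl F"
    using that ecl_mono[of F "E \<union> F"] by auto
  thus ?case
    using ncomp_insert[OF assms(1) p(2,3), of F] ncomp_insert[OF assms(1) p(2,3), of "E \<union> F"] insert
    by (auto simp: p split: if_splits)
qed

section \<open>Cycles and connected components\<close>

definition gr :: "'a set \<Rightarrow> ('a \<Rightarrow> 'a) \<Rightarrow> ('a \<times> 'a) set" where
  "gr A f = (\<lambda>x. (x, f x)) ` A"

lemma gr_subset: "f permutes A \<Longrightarrow> gr A f \<subseteq> A \<times> A"
  by (auto simp: gr_def permutes_in_image)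

lemma ecl_gr_step: "f permutes A \<Longrightarrow> (x, f x) \<in> ecl (gr A f)"
  by (cases "x \<in> A") (auto simp: gr_def permutes_not_in intro: ecl_base)

lemma orbit_subset_ecl:
  assumes "f permutes A"
  shows "Orbits.orbit f x \<subseteq> ecl (gr A f) `` {x}"
proof
  fix y assume "y \<in> Orbits.orbit f x"
  thus "y \<in> ecl (gr A f) `` {x}"
    by induction (auto intro: ecl_trans ecl_gr_step[OF assms])
qed

lemma orbit_eq_ecl:
  assumes "f permutes A" "finite A"
  shows "Orbits.orbit f x = ecl (gr A f) `` {x}"
proof
  have perm: "permutation f" using assms permutation_permutes by blast
  show "ecl (gr A f) `` {x} \<subseteq> Orbits.orbit f x"
  proof
    fix y assume "y \<in> ecl (gr A f) `` {x}"
    hence "(x, y) \<in> (gr A f \<union> (gr A f)\<inverse>)\<^sup>*" by (simp add: ecl_def)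
    thus "y \<in> Orbits.orbit f x"
    proof induction
      case base
      show ?case using perm by (rule permutation_self_in_orbit)
    next
      case (step y w)
      then consider "w = f y" | "y = f w" by (auto simp: gr_def)
      thus ?case
      proof cases
        case 1
        thus ?thesis using step.IH by (auto intro: Orbits.orbit.step)
      next
        \<comment> \<open>A backward edge: the cycle of a permutation returns to its start, so
          \<open>w\<close> is reachable from \<open>f w\<close>, which is \<open>y\<close>.\<close>
        case 2
        have "w \<in> Orbits.orbit f (f w)"
          using perm permutation_orbit_step permutation_self_in_orbit by metis
        thus ?thesis using step.IH 2 by (metis orbit_trans)
      qed
    qed
  qed
qed (rule orbit_subset_ecl[OF assms(1)])

lemma same_cycle_iff:
  assumes "f permutes A" "finite A"
  shows "same_cycle f i j \<longleftrightarrow> (i, j) \<in> ecl (gr A f)"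
  by (simp add: same_cycle_def orbit_eq_ecl[OF assms] ecl_class_eq_iff)

lemma z_eq_ncomp:
  assumes "f permutes A" "finite A"
  shows "z A f = ncomp A (gr A f)"
  by (simp add: z_def ncomp_def orbit_eq_ecl[OF assms])

section \<open>Orbits of the group generated by two permutations\<close>

lemma generate_orbit:
  assumes "\<sigma> permutes {1..n}" "\<alpha> permutes {1..n}"
  shows "{g x | g. g \<in> generate (sym_group n) {\<sigma>, \<alpha>}} = ecl (gr {1..n} \<sigma> \<union> gr {1..n} \<alpha>) `` {x}"
    (is "?L = ecl ?E `` {x}")
proof (intro subset_antisym subsetI)
  have E: "ecl (gr {1..n} \<sigma>) \<subseteq> ecl ?E" "ecl (gr {1..n} \<alpha>) \<subseteq> ecl ?E"
    by (auto intro!: ecl_mono)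
  have step: "(y, h y) \<in> ecl ?E" if "h \<in> {\<sigma>, \<alpha>}" for h y
    using that ecl_gr_step[OF assms(1), of y] ecl_gr_step[OF assms(2), of y] E by auto
  fix y assume "y \<in> ?L"
  then obtain g where g: "g \<in> generate (sym_group n) {\<sigma>, \<alpha>}" "y = g x" by auto
  from g(1) have "(w, g w) \<in> ecl ?E" for w
  proof (induction arbitrary: w)
    \<comment> \<open>An inverse generator runs backwards along the edge from
      \<open>inv' h w\<close> to \<open>w\<close>.\<close>
    case (inv h)
    have h: "h permutes {1..n}" using inv assms by auto
    have "(inv' h w, h (inv' h w)) \<in> ecl ?E" using step[OF inv] .
    thus ?case using h by (simp add: sym_group_carrier permutes_inverses ecl_sym)
  next
    case (eng h1 h2)
    have "(w, h2 w) \<in> ecl ?E" "(h2 w, h1 (h2 w)) \<in> ecl ?E" by (rule eng.IH)+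
    thus ?case by (auto simp: sym_group_mult intro: ecl_trans)
  qed (auto simp: sym_group_one step[simplified])
  thus "y \<in> ecl ?E `` {x}" using g(2) by auto
next
  let ?G = "generate (sym_group n) {\<sigma>, \<alpha>}"
  fix y assume "y \<in> ecl ?E `` {x}"
  hence "(x, y) \<in> (?E \<union> ?E\<inverse>)\<^sup>*" by (simp add: ecl_def)
  hence "\<exists>g\<in>?G. y = g x"
  proof induction
    case base
    show ?case using generate.one[of "sym_group n" "{\<sigma>, \<alpha>}"]
      by (intro bexI[of _ id]) (auto simp: sym_group_one)
  next
    case (step y w)
    then obtain g where g: "g \<in> ?G" "y = g x" by auto
    from step(2) obtain h where h: "h \<in> {\<sigma>, \<alpha>}" "w = h y \<or> y = h w"
      by (auto simp: gr_def)
    have hp: "h permutes {1..n}" using h assms by auto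
    \<comment> \<open>A forward edge extends the group element by a generator on the left, a
      backward edge by its inverse.\<close>
    have "h \<circ> g \<in> ?G" "inv' h \<circ> g \<in> ?G"
      using generate.eng[OF generate.incl[OF h(1)] g(1)] generate.eng[OF generate.inv[OF h(1)] g(1)]
        hp by (simp_all add: sym_group_mult sym_group_carrier)
    moreover have "w = (h \<circ> g) x \<or> w = (inv' h \<circ> g) x"
      using h(2) g(2) hp by (auto simp: permutes_inverses)
    ultimately show ?case by blast
  qed
  thus "y \<in> ?L" by auto
qed

text \<open>Replaces the group action by the classes of a union of two graphs, in which both
  permutations have symmetric roles.\<close>

lemma \<kappa>_eq_ncomp:
  assumes "\<sigma> permutes {1..n}" "\<alpha> permutes {1..n}"
  shows "\<kappa> n \<sigma> \<alpha> = ncomp {1..n} (gr {1..n} \<sigma> \<union> gr {1..n} \<alpha>)"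
proof -
  have "orbits ((sym_group n)\<lparr>carrier := generate (sym_group n) {\<sigma>, \<alpha>}\<rparr>) {1..n} (\<lambda>g. g)
        = (\<lambda>x. ecl (gr {1..n} \<sigma> \<union> gr {1..n} \<alpha>) `` {x}) ` {1..n}"
    unfolding orbits_def Group_Action.orbit_def
    using generate_orbit[OF assms] by (auto simp: image_def)
  thus ?thesis by (simp add: \<kappa>_def ncomp_def)
qed

text \<open>If \<open>(i, j)\<close> were not in the closure of the new graph, the cycle of \<open>i\<close> under \<open>f\<close> would
  survive unchanged up to the predecessor of \<open>i\<close>, which is now sent to \<open>j\<close>.\<close>

lemma ecl_gr_transpose:
  assumes f: "f permutes A" "finite A" and ij: "i \<in> A" "j \<in> A" "(i, j) \<notin> ecl (gr A f)"
  shows "ecl (gr A (transpose i j \<circ> f)) = ecl (insert (i, j) (gr A f))"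
proof (rule ecl_cong)
  let ?h = "transpose i j \<circ> f"
  have h: "?h permutes A" using assms by (intro permutes_compose permutes_swap_id)
  have *: "(i, j) \<in> ecl (gr A ?h)"
  proof (rule ccontr)
    assume no: "(i, j) \<notin> ecl (gr A ?h)"
    have "(i, y) \<in> ecl (gr A ?h)" if "y \<in> Orbits.orbit f i" for y
      using that
    proof induction
      case base
      have "f i \<noteq> j" using ij(3) ecl_gr_step[OF f(1), of i] by auto
      moreover have "f i \<noteq> i"
        using no ecl_gr_step[OF h, of i] by auto
      ultimately have "?h i = f i" by simp
      thus ?case using ecl_gr_step[OF h, of i] by metis
    next
      case (step y)
      have "f y \<noteq> j"
        using step(1) ij(3) orbit_eq_ecl[OF f, of i] Orbits.orbit.step[of y f i] by auto
      moreover have *: "(i, ?h y) \<in> ecl (gr A ?h)"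
        using ecl_gr_step[OF h, of y] step.IH ecl_trans by metis
      hence "f y \<noteq> i" using no by auto
      ultimately have "?h y = f y" by simp
      thus ?case using * by metis
    qed
    moreover have "inv' f i \<in> Orbits.orbit f i"
      using ecl_gr_step[OF f(1), of "inv' f i"]
      by (auto simp: orbit_eq_ecl[OF f] permutes_inverses[OF f(1)] intro: ecl_sym)
    ultimately have "(i, inv' f i) \<in> ecl (gr A ?h)" by blast
    thus False using ecl_gr_step[OF h, of "inv' f i"] no
      by (auto simp: permutes_inverses[OF f(1)] intro: ecl_trans)
  qed
  \<comment> \<open>\<open>f x\<close> and \<open>?h x\<close> differ only if one of them is
    \<open>i\<close> and the other \<open>j\<close>, and these two points are joined in both
    closures.\<close>
  have "(f x, ?h x) \<in> ecl (insert (i, j) E) \<and> (f x, ?h x) \<in> ecl (gr A ?h)" for x E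
    using * by (auto simp: transpose_def ecl_insert_iff intro: ecl_sym)
  note link = this[THEN conjunct1] this[THEN conjunct2]
  have "(x, f x) \<in> ecl (insert (i, j) (gr A f))" for x
    using ecl_gr_step[OF f(1), of x] by (simp add: ecl_insert_iff)
  hence "(x, ?h x) \<in> ecl (insert (i, j) (gr A f))" for x
    using link(1) ecl_trans by metis
  thus "gr A ?h \<subseteq> ecl (insert (i, j) (gr A f))" unfolding gr_def[of A ?h] by blast
  have "(x, f x) \<in> ecl (gr A ?h)" for x
    using link(2) ecl_gr_step[OF h, of x] ecl_trans ecl_sym by metis
  thus "insert (i, j) (gr A f) \<subseteq> ecl (gr A ?h)" using * by (auto simp: gr_def[of A f])
qed

section \<open>Refinements on a 3-cycle\<close>

lemma orbit_two:
  assumes "f x = y" "f y = x"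
  shows "Orbits.orbit f x = {x, y}"
proof
  show "Orbits.orbit f x \<subseteq> {x, y}"
  proof
    fix w assume "w \<in> Orbits.orbit f x"
    thus "w \<in> {x, y}" by induction (use assms in auto)
  qed
  show "{x, y} \<subseteq> Orbits.orbit f x"
    using Orbits.orbit.base[of f x] Orbits.orbit.step[of y f x] assms by auto
qed

lemma orbit_three:
  assumes "f x = y" "f y = w" "f w = x"
  shows "Orbits.orbit f x = {x, y, w}"
proof
  show "Orbits.orbit f x \<subseteq> {x, y, w}"
  proof
    fix v assume "v \<in> Orbits.orbit f x"
    thus "v \<in> {x, y, w}" by induction (use assms in auto)
  qed
  show "{x, y, w} \<subseteq> Orbits.orbit f x"
    using Orbits.orbit.base[of f x] Orbits.orbit.step[of y f x] Orbits.orbit.step[of w f x] assms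
    by auto
qed

lemma z_fixed: "(\<And>x. x \<in> A \<Longrightarrow> f x = x) \<Longrightarrow> z A f = card A"
  by (simp add: z_def card_image inj_on_def iffD2[OF orbit_eq_singleton_iff])

lemma z_swap:
  assumes "a \<noteq> b" "a \<noteq> c" "b \<noteq> c" "f a = b" "f b = a" "f c = c"
  shows "z {a, b, c} f = 2"
proof -
  have "Orbits.orbit f ` {a, b, c} = {{a, b}, {c}}"
    using assms orbit_two[of f a b] orbit_two[of f b a] iffD2[OF orbit_eq_singleton_iff[of f c]]
    by auto
  thus ?thesis using assms by (simp add: z_def doubleton_eq_iff)
qed

lemma z_three_cycle:
  assumes "f a = b" "f b = c" "f c = a"
  shows "z {a, b, c} f = 1"
proof -
  have "Orbits.orbit f ` {a, b, c} = {{a, b, c}}"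
    using assms orbit_three[of f a b c] orbit_three[of f b c a] orbit_three[of f c a b]
    by auto
  thus ?thesis by (simp add: z_def)
qed

text \<open>The condition at a single cycle, so that \<open>{a, b, c}\<close> and the remaining
  cycles can be treated separately.\<close>

definition refines_on :: "(nat \<Rightarrow> nat) \<Rightarrow> (nat \<Rightarrow> nat) \<Rightarrow> nat set \<Rightarrow> bool" where
  "refines_on \<beta> \<alpha> C \<longleftrightarrow> \<beta> ` C = C \<and>
     card C + 2 = z C (perm_restrict \<beta> C) + z C (perm_restrict \<alpha> C)
                  + z C (inv' (perm_restrict \<alpha> C) \<circ> perm_restrict \<beta> C)"

lemma refines_iff:
  "refines n \<beta> \<alpha> \<longleftrightarrow> \<beta> permutes {1..n} \<and> (\<forall>C \<in> Orbits.orbit \<alpha> ` {1..n}. refines_on \<beta> \<alpha> C)"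
  by (simp add: refines_def refines_on_def Let_def)

text \<open>All cycle counts concern restrictions to \<open>C\<close>, so a permutation may be
  changed freely outside \<open>C\<close>.\<close>

lemma refines_on_cong:
  assumes "\<And>x. x \<in> C \<Longrightarrow> \<beta> x = \<beta>' x" "\<And>x. x \<in> C \<Longrightarrow> \<alpha> x = \<alpha>' x"
  shows "refines_on \<beta> \<alpha> C \<longleftrightarrow> refines_on \<beta>' \<alpha>' C"
proof -
  have "perm_restrict \<beta> C = perm_restrict \<beta>' C" "perm_restrict \<alpha> C = perm_restrict \<alpha>' C"
    using assms by (auto simp: perm_restrict_def)
  moreover have "\<beta> ` C = \<beta>' ` C" using assms(1) by (intro image_cong) auto
  ultimately show ?thesis by (simp add: refines_on_def)
qed

lemma refines_on_fixed:
  assumes "\<alpha> x = x"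
  shows "refines_on \<beta> \<alpha> {x} \<longleftrightarrow> \<beta> x = x"
proof
  assume "\<beta> x = x"
  hence "perm_restrict \<beta> {x} = id" "perm_restrict \<alpha> {x} = id"
    using assms by (auto simp: perm_restrict_def)
  moreover have "z {x} id = 1" by (simp add: z_fixed)
  ultimately show "refines_on \<beta> \<alpha> {x}" using \<open>\<beta> x = x\<close> by (simp add: refines_on_def)
qed (simp add: refines_on_def)

text \<open>As \<gamma> is a single cycle on three points, genus zero means that the cycle counts of
  \<theta> and of \<open>inv' \<gamma> \<circ> \<theta>\<close> add up to 4. The identity gives 3 +
  1, a transposition 2 + 2, the cycle itself 1 + 3, but the inverse cycle only 1 + 1.\<close>

lemma refines_on_three_cycle:
  assumes "is_three_cycle \<alpha> a b c"
  shows "refines_on \<beta> \<alpha> {a, b, c} \<longleftrightarrow>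
    (\<beta> a, \<beta> b, \<beta> c) \<in> {(a, b, c), (b, a, c), (c, b, a), (a, c, b), (b, c, a)}"
proof -
  let ?C = "{a, b, c}"
  define \<gamma> \<theta> where "\<gamma> = perm_restrict \<alpha> ?C" and "\<theta> = perm_restrict \<beta> ?C"
  have d: "a \<noteq> b" "a \<noteq> c" "b \<noteq> c" "b \<noteq> a" "c \<noteq> a" "c \<noteq> b" and \<alpha>: "\<alpha> a = b" "\<alpha> b = c" "\<alpha> c = a"
    using assms by (auto simp: is_three_cycle_def)
  have \<gamma>: "\<gamma> a = b" "\<gamma> b = c" "\<gamma> c = a" by (simp_all add: \<gamma>_def perm_restrict_def \<alpha>)
  have "inj \<gamma>" by (rule injI) (auto simp: \<gamma>_def perm_restrict_def \<alpha> d split: if_splits)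
  hence i: "inv' \<gamma> b = a" "inv' \<gamma> c = b" "inv' \<gamma> a = c" using \<gamma> inv_f_f by metis+
  have \<theta>: "\<theta> a = \<beta> a" "\<theta> b = \<beta> b" "\<theta> c = \<beta> c"
    by (simp_all add: \<theta>_def perm_restrict_def)
  have z3: "z ?C f = 3" if "f a = a" "f b = b" "f c = c" for f
    using that d by (subst z_fixed) auto
  \<comment> \<open>Orders of the points that put the fixed point last for \<open>z_swap\<close> and
    list the inverse cycle for \<open>z_three_cycle\<close>.\<close>
  have perm: "?C = {a, c, b}" "?C = {b, c, a}" by blast+
  have z2: "z ?C f = 2"
    if "f a = b \<and> f b = a \<and> f c = c \<or> f a = c \<and> f c = a \<and> f b = b \<or> f b = c \<and> f c = b \<and> f a = a" for f
    using that
  proof (elim disjE conjE)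
    assume "f a = b" "f b = a" "f c = c"
    thus ?thesis using d by (intro z_swap)
  next
    assume "f a = c" "f c = a" "f b = b"
    thus ?thesis using d unfolding perm(1) by (intro z_swap)
  next
    assume "f b = c" "f c = b" "f a = a"
    thus ?thesis using d unfolding perm(2) by (intro z_swap)
  qed
  have z1: "z ?C f = 1"
    if "f a = b \<and> f b = c \<and> f c = a \<or> f a = c \<and> f c = b \<and> f b = a" for f
    using that z_three_cycle[of f a b c] z_three_cycle[of f a c b] perm(1) by metis
  have z\<gamma>: "z ?C \<gamma> = 1" by (rule z1) (simp add: \<gamma>)
  have iff: "refines_on \<beta> \<alpha> ?C \<longleftrightarrow> \<beta> ` ?C = ?C \<and> 4 = z ?C \<theta> + z ?C (inv' \<gamma> \<circ> \<theta>)"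
    using d by (auto simp: refines_on_def \<gamma>_def[symmetric] \<theta>_def[symmetric] z\<gamma>)
  show ?thesis
  proof
    assume "(\<beta> a, \<beta> b, \<beta> c) \<in> {(a, b, c), (b, a, c), (c, b, a), (a, c, b), (b, c, a)}"
    then consider "\<beta> a = a" "\<beta> b = b" "\<beta> c = c" | "\<beta> a = b" "\<beta> b = a" "\<beta> c = c"
      | "\<beta> a = c" "\<beta> b = b" "\<beta> c = a" | "\<beta> a = a" "\<beta> b = c" "\<beta> c = b"
      | "\<beta> a = b" "\<beta> b = c" "\<beta> c = a" by auto
    thus "refines_on \<beta> \<alpha> ?C"
    proof cases
      case 1
      have "z ?C \<theta> = 3" by (rule z3) (simp_all add: \<theta> 1)
      moreover have "z ?C (inv' \<gamma> \<circ> \<theta>) = 1" by (rule z1) (simp add: \<theta> 1 i)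
      ultimately show ?thesis using 1 by (simp add: iff)
    next
      case 2
      have "z ?C \<theta> = 2" by (rule z2) (simp add: \<theta> 2)
      moreover have "z ?C (inv' \<gamma> \<circ> \<theta>) = 2" by (rule z2) (simp add: \<theta> i 2)
      moreover have "\<beta> ` ?C = ?C" using 2 by auto
      ultimately show ?thesis by (simp add: iff)
    next
      case 3
      have "z ?C \<theta> = 2" by (rule z2) (simp add: \<theta> 3)
      moreover have "z ?C (inv' \<gamma> \<circ> \<theta>) = 2" by (rule z2) (simp add: \<theta> i 3)
      moreover have "\<beta> ` ?C = ?C" using 3 by auto
      ultimately show ?thesis by (simp add: iff)
    next
      case 4
      have "z ?C \<theta> = 2" by (rule z2) (simp add: \<theta> 4)
      moreover have "z ?C (inv' \<gamma> \<circ> \<theta>) = 2" by (rule z2) (simp add: \<theta> i 4)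
      moreover have "\<beta> ` ?C = ?C" using 4 by auto
      ultimately show ?thesis by (simp add: iff)
    next
      case 5
      have "z ?C \<theta> = 1" by (rule z1) (simp add: \<theta> 5)
      moreover have "z ?C (inv' \<gamma> \<circ> \<theta>) = 3" by (rule z3) (simp_all add: \<theta> 5 i)
      moreover have "\<beta> ` ?C = ?C" using 5 by auto
      ultimately show ?thesis by (simp add: iff)
    qed
  next
    assume r: "refines_on \<beta> \<alpha> ?C"
    hence im: "{\<beta> a, \<beta> b, \<beta> c} = {a, b, c}" by (simp add: iff)
    have triple: "(p, q, r) \<in> {(a, b, c), (b, a, c), (c, b, a), (a, c, b), (b, c, a)}"
      if "\<not> (p = c \<and> q = a \<and> r = b)" "p \<in> ?C" "q \<in> ?C" "r \<in> ?C" "p \<noteq> q" "p \<noteq> r" "q \<noteq> r" for p q r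
      using that by auto
    \<comment> \<open>The inverse cycle is the one bijection to exclude: here
      \<open>inv' \<gamma> \<circ> \<theta>\<close> acts as \<gamma> itself, so the two counts sum
      to 2.\<close>
    have "\<not> (\<beta> a = c \<and> \<beta> b = a \<and> \<beta> c = b)"
    proof
      assume 4: "\<beta> a = c \<and> \<beta> b = a \<and> \<beta> c = b"
      have "z ?C \<theta> = 1" by (rule z1) (simp add: \<theta> 4)
      moreover have "z ?C (inv' \<gamma> \<circ> \<theta>) = 1" by (rule z1) (simp add: \<theta> 4 i)
      ultimately show False using r by (simp add: iff)
    qed
    moreover have "\<beta> a \<in> ?C" "\<beta> b \<in> ?C" "\<beta> c \<in> ?C" using im by blast+
    moreover have "\<beta> a \<noteq> \<beta> b" "\<beta> a \<noteq> \<beta> c" "\<beta> b \<noteq> \<beta> c"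
    proof -
      have "inj_on \<beta> ?C" by (rule eq_card_imp_inj_on) (use im in simp_all)
      thus "\<beta> a \<noteq> \<beta> b" "\<beta> a \<noteq> \<beta> c" "\<beta> b \<noteq> \<beta> c"
        using d by (simp_all add: inj_on_def)
    qed
    ultimately show "(\<beta> a, \<beta> b, \<beta> c) \<in> {(a, b, c), (b, a, c), (c, b, a), (a, c, b), (b, c, a)}"
      by (rule triple)
  qed
qed

text \<open>The last element sends \<open>a\<close> to \<open>b\<close>, \<open>b\<close> to
  \<open>c\<close> and \<open>c\<close> to \<open>a\<close>. Products of transpositions allow cycles
  to be merged one pair at a time.\<close>

definition nc3 :: "'a \<Rightarrow> 'a \<Rightarrow> 'a \<Rightarrow> ('a \<Rightarrow> 'a) set" where
  "nc3 a b c = {id, transpose a b, transpose a c, transpose b c, transpose a c \<circ> transpose a b}"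

lemma nc3_permutes: "\<tau> \<in> nc3 a b c \<Longrightarrow> \<tau> permutes {a, b, c}"
  unfolding nc3_def by (auto intro!: permutes_compose permutes_swap_id permutes_id)

text \<open>The triples are those of \<open>refines_on_three_cycle\<close>, so the restriction of a
  refinement to the three points is recognized as a member of \<open>nc3 a b c\<close>.\<close>

lemma nc3_iff:
  assumes "distinct [a, b, c]"
  shows "\<tau> \<in> nc3 a b c \<longleftrightarrow> \<tau> permutes {a, b, c} \<and>
    (\<tau> a, \<tau> b, \<tau> c) \<in> {(a, b, c), (b, a, c), (c, b, a), (a, c, b), (b, c, a)}"
    (is "_ \<longleftrightarrow> _ \<and> _ \<in> ?S")
proof -
  have d: "a \<noteq> b" "a \<noteq> c" "b \<noteq> c" "b \<noteq> a" "c \<noteq> a" "c \<noteq> b" using assms by auto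
  have "(\<tau> a, \<tau> b, \<tau> c) \<in> ?S" if "\<tau> \<in> nc3 a b c"
    using that unfolding nc3_def by (elim insertE emptyE) (simp_all add: d)
  moreover have "\<tau> \<in> nc3 a b c" if \<tau>: "\<tau> permutes {a, b, c}" "(\<tau> a, \<tau> b, \<tau> c) \<in> ?S"
  proof -
    have eq: "\<tau> \<in> nc3 a b c" if "f \<in> nc3 a b c" "\<tau> a = f a" "\<tau> b = f b" "\<tau> c = f c" for f
    proof -
      have "\<tau> x = f x" for x
        using that(2-4) permutes_not_in[OF \<tau>(1), of x] permutes_not_in[OF nc3_permutes[OF that(1)], of x]
        by (cases "x \<in> {a, b, c}") auto
      hence "\<tau> = f" by blast
      thus ?thesis using that(1) by simp
    qed
    from \<tau>(2) consider "\<tau> a = a" "\<tau> b = b" "\<tau> c = c" | "\<tau> a = b" "\<tau> b = a" "\<tau> c = c"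
      | "\<tau> a = c" "\<tau> b = b" "\<tau> c = a" | "\<tau> a = a" "\<tau> b = c" "\<tau> c = b"
      | "\<tau> a = b" "\<tau> b = c" "\<tau> c = a" by auto
    thus ?thesis
    proof cases
      case 1 show ?thesis by (rule eq[of id]) (use 1 in \<open>simp_all add: nc3_def\<close>)
    next
      case 2 show ?thesis by (rule eq[of "transpose a b"]) (use 2 d in \<open>simp_all add: nc3_def\<close>)
    next
      case 3 show ?thesis by (rule eq[of "transpose a c"]) (use 3 d in \<open>simp_all add: nc3_def\<close>)
    next
      case 4 show ?thesis by (rule eq[of "transpose b c"]) (use 4 d in \<open>simp_all add: nc3_def\<close>)
    next
      case 5 show ?thesis
        by (rule eq[of "transpose a c \<circ> transpose a b"]) (use 5 d in \<open>simp_all add: nc3_def\<close>)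
    qed
  qed
  ultimately show ?thesis using nc3_permutes[of \<tau> a b c] by argo
qed

section \<open>Sums over refinements\<close>

lemma sum_nc3:
  assumes "distinct [a, b, c]"
  shows "sum f (nc3 a b c) = f id + f (transpose a b) + f (transpose a c) + f (transpose b c)
           + f (transpose a c \<circ> transpose a b)"
proof -
  have d: "a \<noteq> b" "a \<noteq> c" "b \<noteq> c" "b \<noteq> a" "c \<noteq> a" "c \<noteq> b" using assms by auto
  \<comment> \<open>The images of \<open>a\<close> and \<open>b\<close> already tell the five
    permutations apart.\<close>
  have ne: "g \<noteq> h" if "g a \<noteq> h a \<or> g b \<noteq> h b" for g h :: "'a \<Rightarrow> 'a"
    using that by auto
  have "id \<noteq> transpose a b" "id \<noteq> transpose a c" "id \<noteq> transpose b c"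
    "id \<noteq> transpose a c \<circ> transpose a b" "transpose a b \<noteq> transpose a c"
    "transpose a b \<noteq> transpose b c" "transpose a b \<noteq> transpose a c \<circ> transpose a b"
    "transpose a c \<noteq> transpose b c" "transpose a c \<noteq> transpose a c \<circ> transpose a b"
    "transpose b c \<noteq> transpose a c \<circ> transpose a b"
    by (rule ne; simp add: d)+
  thus ?thesis unfolding nc3_def by (simp add: add.assoc)
qed

section \<open>Component counts and connectivity under refinement\<close>

lemma \<kappa>_commute:
  "\<sigma> permutes {1..n} \<Longrightarrow> \<beta> permutes {1..n} \<Longrightarrow> \<kappa> n \<sigma> \<beta> = \<kappa> n \<beta> \<sigma>"
  by (simp add: \<kappa>_eq_ncomp Un_commute)

text \<open>\<open>ncomp_Un_ge\<close> for the two graphs. It makes the truncated subtractions in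
  the exponent of \<open>var_v\<close> exact.\<close>

lemma z_add_z_le:
  assumes "\<sigma> permutes {1..n}" "\<beta> permutes {1..n}"
  shows "z {1..n} \<sigma> + z {1..n} \<beta> \<le> \<kappa> n \<sigma> \<beta> + n"
proof -
  have "finite (gr {1..n} \<beta>)" by (simp add: gr_def)
  from ncomp_Un_ge[OF _ this gr_subset[OF assms(2)], of "gr {1..n} \<sigma>"] show ?thesis
    by (simp add: z_eq_ncomp assms \<kappa>_eq_ncomp)
qed

text \<open>A refinement maps every cycle of \<alpha> to itself, so \<open>x\<close> and
  \<open>\<beta> x\<close> always share a cycle of \<alpha>.\<close>

lemma refines_ecl_subset:
  assumes "refines n \<beta> \<alpha>" "\<alpha> permutes {1..n}"
  shows "ecl (gr {1..n} \<beta>) \<subseteq> ecl (gr {1..n} \<alpha>)"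
proof (rule ecl_subset)
  have "(x, \<beta> x) \<in> ecl (gr {1..n} \<alpha>)" if "x \<in> {1..n}" for x
  proof -
    have C: "Orbits.orbit \<alpha> x = ecl (gr {1..n} \<alpha>) `` {x}"
      using assms(2) by (intro orbit_eq_ecl) auto
    have "refines_on \<beta> \<alpha> (Orbits.orbit \<alpha> x)" using assms(1) that by (simp add: refines_iff)
    hence "\<beta> ` (ecl (gr {1..n} \<alpha>) `` {x}) = ecl (gr {1..n} \<alpha>) `` {x}"
      by (simp add: refines_on_def C)
    thus ?thesis using ecl_refl[of x] by blast
  qed
  thus "gr {1..n} \<beta> \<subseteq> ecl (gr {1..n} \<alpha>)" by (auto simp: gr_def)
qed

definition conn :: "nat \<Rightarrow> (nat \<Rightarrow> nat) \<Rightarrow> (nat \<Rightarrow> nat) \<Rightarrow> nat \<Rightarrow> nat \<Rightarrow> bool" where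
  "conn n \<sigma> \<beta> x y \<longleftrightarrow> (x, y) \<in> ecl (gr {1..n} \<sigma> \<union> gr {1..n} \<beta>)"

lemma conn_sym: "conn n \<sigma> \<beta> x y \<Longrightarrow> conn n \<sigma> \<beta> y x"
  unfolding conn_def by (rule ecl_sym)

lemma conn_refl: "conn n \<sigma> \<beta> x x"
  by (simp add: conn_def)

lemma conn_trans: "conn n \<sigma> \<beta> x y \<Longrightarrow> conn n \<sigma> \<beta> y w \<Longrightarrow> conn n \<sigma> \<beta> x w"
  unfolding conn_def by (rule ecl_trans)

lemma conn_commute: "conn n \<sigma> \<beta> = conn n \<beta> \<sigma>"
  by (simp add: conn_def fun_eq_iff Un_commute)

lemma conn_of_same_cycle:
  "\<sigma> permutes {1..n} \<Longrightarrow> same_cycle \<sigma> x y \<Longrightarrow> conn n \<sigma> \<beta> x y"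
  using ecl_mono[of "gr {1..n} \<sigma>" "gr {1..n} \<sigma> \<union> gr {1..n} \<beta>"]
  by (auto simp: same_cycle_iff conn_def)

lemma conn_refines_mono:
  assumes "refines n \<beta> \<alpha>" "\<alpha> permutes {1..n}" "conn n \<sigma> \<beta> x y"
  shows "conn n \<sigma> \<alpha> x y"
proof -
  have "gr {1..n} \<sigma> \<union> gr {1..n} \<beta> \<subseteq> ecl (gr {1..n} \<sigma> \<union> gr {1..n} \<alpha>)"
    using refines_ecl_subset[OF assms(1,2)] subset_ecl[of "gr {1..n} \<beta>"]
      ecl_mono[of "gr {1..n} \<alpha>" "gr {1..n} \<sigma> \<union> gr {1..n} \<alpha>"]
      subset_ecl[of "gr {1..n} \<sigma> \<union> gr {1..n} \<alpha>"] by blast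
  from ecl_subset[OF this] assms(3) show ?thesis by (auto simp: conn_def)
qed

text \<open>Passing to a refinement can only cut connections. This makes the truncated subtraction
  in the exponent of \<open>var_u\<close> exact.\<close>

lemma \<kappa>_refines_mono:
  assumes "refines n \<beta> \<alpha>" "\<alpha> permutes {1..n}" "\<sigma> permutes {1..n}"
  shows "\<kappa> n \<sigma> \<alpha> \<le> \<kappa> n \<sigma> \<beta>"
proof -
  have "\<beta> permutes {1..n}" using assms(1) by (simp add: refines_def)
  moreover have "ecl (gr {1..n} \<sigma> \<union> gr {1..n} \<beta>) \<subseteq> ecl (gr {1..n} \<sigma> \<union> gr {1..n} \<alpha>)"
    using conn_refines_mono[OF assms(1,2), of \<sigma>] by (auto simp: conn_def)
  ultimately show ?thesis using assms by (auto simp: \<kappa>_eq_ncomp intro: ncomp_mono)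
qed

section \<open>Merging two cycles by a transposition\<close>

context
  fixes n \<sigma> \<beta> i j
  assumes perm: "\<sigma> permutes {1..n}" "\<beta> permutes {1..n}"
    and ij: "i \<in> {1..n}" "j \<in> {1..n}" "\<not> same_cycle \<beta> i j"
begin

lemma transpose_comp_permutes: "transpose i j \<circ> \<beta> permutes {1..n}"
  using perm ij by (intro permutes_compose permutes_swap_id)

lemma ecl_transpose_comp:
  "ecl (gr {1..n} (transpose i j \<circ> \<beta>)) = ecl (insert (i, j) (gr {1..n} \<beta>))"
  using perm ij by (intro ecl_gr_transpose) (auto simp: same_cycle_iff)

lemma ecl_Un_transpose_comp:
  "ecl (gr {1..n} \<sigma> \<union> gr {1..n} (transpose i j \<circ> \<beta>))
     = ecl (insert (i, j) (gr {1..n} \<sigma> \<union> gr {1..n} \<beta>))"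
  using ecl_Un_cong[OF refl ecl_transpose_comp, of "gr {1..n} \<sigma>"] by simp

lemma z_transpose_comp: "z {1..n} \<beta> = Suc (z {1..n} (transpose i j \<circ> \<beta>))"
  using perm ij ncomp_insert_new[of "{1..n}" i j "gr {1..n} \<beta>"]
  by (simp add: z_eq_ncomp transpose_comp_permutes same_cycle_iff ncomp_cong[OF ecl_transpose_comp])

lemma same_cycle_transpose_comp:
  "same_cycle (transpose i j \<circ> \<beta>) x y \<longleftrightarrow>
     same_cycle \<beta> x y \<or> same_cycle \<beta> x i \<and> same_cycle \<beta> j y \<or> same_cycle \<beta> x j \<and> same_cycle \<beta> i y"
  using perm by (simp add: same_cycle_iff[OF _ finite_atLeastAtMost] transpose_comp_permutes
      same_cycle_iff[OF transpose_comp_permutes] ecl_transpose_comp ecl_insert_iff)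

lemma conn_transpose_comp:
  "conn n \<sigma> (transpose i j \<circ> \<beta>) x y \<longleftrightarrow>
     conn n \<sigma> \<beta> x y \<or> conn n \<sigma> \<beta> x i \<and> conn n \<sigma> \<beta> j y \<or> conn n \<sigma> \<beta> x j \<and> conn n \<sigma> \<beta> i y"
  by (simp add: conn_def ecl_Un_transpose_comp ecl_insert_iff)

text \<open>Merging the cycles amounts to adding an edge from \<open>i\<close> to \<open>j\<close>,
  which costs a component unless the two points are connected already.\<close>

lemma \<kappa>_transpose_comp:
  "\<kappa> n \<sigma> \<beta> = \<kappa> n \<sigma> (transpose i j \<circ> \<beta>) + (if conn n \<sigma> \<beta> i j then 0 else 1)"
  using perm ij ncomp_insert[of "{1..n}" i j "gr {1..n} \<sigma> \<union> gr {1..n} \<beta>"]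
  by (simp add: \<kappa>_eq_ncomp transpose_comp_permutes conn_def ncomp_cong[OF ecl_Un_transpose_comp])

end

section \<open>Factoring the refinements of a permutation with a 3-cycle\<close>

locale hypermap_three_cycle =
  fixes n :: nat and \<sigma> \<alpha> :: "nat \<Rightarrow> nat" and a b c :: nat
  assumes \<sigma>_perm: "\<sigma> permutes {1..n}" and \<alpha>_perm: "\<alpha> permutes {1..n}"
    and cycle: "is_three_cycle \<alpha> a b c"
begin

abbreviation "\<alpha>' \<equiv> split_cycle \<alpha> a b c"

lemma distinct: "a \<noteq> b" "a \<noteq> c" "b \<noteq> c" "b \<noteq> a" "c \<noteq> a" "c \<noteq> b"
  and \<alpha>_simps: "\<alpha> a = b" "\<alpha> b = c" "\<alpha> c = a"
  using cycle by (auto simp: is_three_cycle_def)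

lemma \<alpha>_notin:
  assumes "x \<notin> {a, b, c}"
  shows "\<alpha> x \<notin> {a, b, c}"
proof -
  have "\<alpha> x \<noteq> \<alpha> a" "\<alpha> x \<noteq> \<alpha> b" "\<alpha> x \<noteq> \<alpha> c"
    using assms by (simp_all add: inj_eq[OF permutes_inj[OF \<alpha>_perm]])
  thus ?thesis by (simp add: \<alpha>_simps)
qed

lemma in_range: "a \<in> {1..n}" "b \<in> {1..n}" "c \<in> {1..n}"
  using permutes_not_in[OF \<alpha>_perm, of a] permutes_not_in[OF \<alpha>_perm, of b]
    permutes_not_in[OF \<alpha>_perm, of c] distinct \<alpha>_simps by fastforce+

lemma \<alpha>'_apply: "\<alpha>' x = (if x \<in> {a, b, c} then x else \<alpha> x)"
  using distinct \<alpha>_simps by (auto simp: split_cycle_def transpose_def)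

lemma \<alpha>'_perm: "\<alpha>' permutes {1..n}"
proof -
  have "\<alpha>' = \<alpha> \<circ> (transpose a c \<circ> transpose c b)"
    by (simp add: split_cycle_def)
  thus ?thesis
    using \<alpha>_perm in_range by (auto intro!: permutes_compose permutes_swap_id)
qed

text \<open>\<open>\<alpha>'\<close> fixes the three points and permutes the others among
  themselves, so it commutes with the 3-cycle. The cycle split off on the right can thus be restored
  on the left, where the merge lemmas apply.\<close>

lemma \<alpha>_eq: "\<alpha> = transpose a c \<circ> transpose a b \<circ> \<alpha>'"
proof
  fix x
  show "\<alpha> x = (transpose a c \<circ> transpose a b \<circ> \<alpha>') x"
    using distinct \<alpha>_notin[of x] by (cases "x \<in> {a, b, c}") (auto simp: \<alpha>'_apply \<alpha>_simps)
qed

text \<open>Translates the condition on \<open>\<alpha> \<circ> transpose b c\<close> for simple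
  bridges into a merge of \<open>a\<close> and \<open>b\<close> in \<open>\<alpha>'\<close>.\<close>

lemma \<alpha>_comp_transpose: "\<alpha> \<circ> transpose b c = transpose a b \<circ> \<alpha>'"
proof
  fix x
  show "(\<alpha> \<circ> transpose b c) x = (transpose a b \<circ> \<alpha>') x"
    using distinct \<alpha>_notin[of x] by (cases "x \<in> {a, b, c}") (auto simp: \<alpha>'_apply \<alpha>_simps)
qed

definition "other_cycles = Orbits.orbit \<alpha> ` ({1..n} - {a, b, c})"

lemma other_cycles_disjoint: "C \<in> other_cycles \<Longrightarrow> C \<inter> {a, b, c} = {}"
proof -
  assume "C \<in> other_cycles"
  then obtain x where x: "x \<notin> {a, b, c}" "C = Orbits.orbit \<alpha> x" by (auto simp: other_cycles_def)
  have "y \<notin> {a, b, c}" if "y \<in> Orbits.orbit \<alpha> x" for y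
    using that by induction (use x(1) \<alpha>_notin in blast)+
  thus ?thesis using x(2) by blast
qed

lemma cycles_\<alpha>: "Orbits.orbit \<alpha> ` {1..n} = insert {a, b, c} other_cycles"
proof -
  have "{1..n} = {a, b, c} \<union> ({1..n} - {a, b, c})" using in_range by blast
  moreover have "Orbits.orbit \<alpha> ` {a, b, c} = {{a, b, c}}"
    using orbit_three[of \<alpha> a b c] orbit_three[of \<alpha> b c a] orbit_three[of \<alpha> c a b] \<alpha>_simps by auto
  ultimately show ?thesis by (metis image_Un insert_is_Un other_cycles_def)
qed

lemma cycles_\<alpha>': "Orbits.orbit \<alpha>' ` {1..n} = {{a}, {b}, {c}} \<union> other_cycles"
proof -
  have "{1..n} = {a, b, c} \<union> ({1..n} - {a, b, c})" using in_range by blast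
  moreover have "Orbits.orbit \<alpha>' x = {x}" if "x \<in> {a, b, c}" for x
    using that \<alpha>'_apply[of x] orbit_eq_singleton_iff by metis
  hence "Orbits.orbit \<alpha>' ` {a, b, c} = {{a}, {b}, {c}}" by simp
  moreover have "Orbits.orbit \<alpha>' x = Orbits.orbit \<alpha> x" if "x \<in> {1..n} - {a, b, c}" for x
  proof (rule orbit_cong)
    show "x \<in> Orbits.orbit \<alpha> x"
      by (rule permutation_self_in_orbit) (use \<alpha>_perm in \<open>auto simp: permutation_permutes\<close>)
    have "Orbits.orbit \<alpha> x \<inter> {a, b, c} = {}"
      using that by (intro other_cycles_disjoint) (auto simp: other_cycles_def)
    thus "\<alpha>' y = \<alpha> y" if "y \<in> Orbits.orbit \<alpha> x" for y
      using that \<alpha>'_apply[of y] by auto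
  qed
  hence "Orbits.orbit \<alpha>' ` ({1..n} - {a, b, c}) = other_cycles"
    by (simp add: other_cycles_def)
  ultimately show ?thesis by (metis image_Un)
qed

lemma refines_\<alpha>_iff:
  "refines n \<beta> \<alpha> \<longleftrightarrow> \<beta> permutes {1..n} \<and>
     (\<beta> a, \<beta> b, \<beta> c) \<in> {(a, b, c), (b, a, c), (c, b, a), (a, c, b), (b, c, a)} \<and>
     (\<forall>C \<in> other_cycles. refines_on \<beta> \<alpha> C)"
  by (simp only: refines_iff cycles_\<alpha> ball_simps refines_on_three_cycle[OF cycle])

text \<open>The remaining cycles are common to \<alpha> and \<open>\<alpha>'\<close>, with the same
  condition on each. Refining one or the other therefore differs only in the values at the three
  points.\<close>

lemma refines_\<alpha>'_iff:
  "refines n \<beta> \<alpha>' \<longleftrightarrow> \<beta> permutes {1..n} \<and> \<beta> a = a \<and> \<beta> b = b \<and> \<beta> c = c \<and>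
     (\<forall>C \<in> other_cycles. refines_on \<beta> \<alpha> C)"
proof -
  have "refines_on \<beta> \<alpha>' C \<longleftrightarrow> refines_on \<beta> \<alpha> C" if "C \<in> other_cycles" for C
    using other_cycles_disjoint[OF that] by (intro refines_on_cong) (auto simp: \<alpha>'_apply)
  moreover have "refines_on \<beta> \<alpha>' {x} \<longleftrightarrow> \<beta> x = x" if "x \<in> {a, b, c}" for x
    using that by (intro refines_on_fixed) (simp add: \<alpha>'_apply)
  ultimately show ?thesis by (simp add: refines_iff cycles_\<alpha>')
qed

text \<open>On the three points \<beta> is the identity, so the product acts as \<tau>; on every
  other cycle \<tau> is the identity, so the product acts as \<beta>.\<close>

lemma nc3_comp_refines:
  assumes \<tau>: "\<tau> \<in> nc3 a b c" and \<beta>: "refines n \<beta> \<alpha>'"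
  shows "refines n (\<tau> \<circ> \<beta>) \<alpha>"
proof -
  have "\<tau> permutes {1..n}"
    using nc3_permutes[OF \<tau>] in_range by (auto intro: permutes_subset)
  moreover have "refines_on (\<tau> \<circ> \<beta>) \<alpha> C" if C: "C \<in> other_cycles" for C
  proof -
    have r: "refines_on \<beta> \<alpha> C" using \<beta> C refines_\<alpha>'_iff by simp
    have "(\<tau> \<circ> \<beta>) x = \<beta> x" if "x \<in> C" for x
    proof -
      have "\<beta> x \<in> C" using r that by (auto simp: refines_on_def)
      thus ?thesis
        using other_cycles_disjoint[OF C] permutes_not_in[OF nc3_permutes[OF \<tau>], of "\<beta> x"] by auto
    qed
    hence "refines_on (\<tau> \<circ> \<beta>) \<alpha> C \<longleftrightarrow> refines_on \<beta> \<alpha> C" by (intro refines_on_cong refl)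
    thus ?thesis using r by simp
  qed
  ultimately show ?thesis
    using \<beta> \<tau> nc3_iff[of a b c \<tau>] distinct unfolding refines_\<alpha>_iff refines_\<alpha>'_iff
    by (simp add: permutes_compose)
qed

text \<open>Take for \<tau> the restriction of \<beta> to the three points and for
  \<open>\<beta>'\<close> what remains after cancelling \<tau> on the left.\<close>

lemma refines_imp_nc3_comp:
  assumes \<beta>: "refines n \<beta> \<alpha>"
  obtains \<tau> \<beta>' where "\<tau> \<in> nc3 a b c" "refines n \<beta>' \<alpha>'" "\<beta> = \<tau> \<circ> \<beta>'"
proof -
  let ?C = "{a, b, c}"
  define \<tau> where "\<tau> = perm_restrict \<beta> ?C"
  have p: "\<beta> permutes {1..n}" and
    t: "(\<beta> a, \<beta> b, \<beta> c) \<in> {(a, b, c), (b, a, c), (c, b, a), (a, c, b), (b, c, a)}"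
    and o: "\<And>C. C \<in> other_cycles \<Longrightarrow> refines_on \<beta> \<alpha> C"
    using \<beta> by (auto simp only: refines_\<alpha>_iff)
  have \<tau>_eq: "\<tau> a = \<beta> a" "\<tau> b = \<beta> b" "\<tau> c = \<beta> c"
    by (simp_all add: \<tau>_def perm_restrict_def)
  have "\<beta> ` ?C = ?C" using t by auto
  hence "bij_betw \<tau> ?C ?C"
    unfolding \<tau>_def bij_betw_def using permutes_inj[OF p]
    by (auto simp: perm_restrict_def inj_on_def inj_def)
  hence \<tau>_perm: "\<tau> permutes ?C"
    by (rule bij_imp_permutes) (simp add: \<tau>_def perm_restrict_def)
  hence \<tau>: "\<tau> \<in> nc3 a b c" using t distinct by (simp add: nc3_iff \<tau>_eq)
  define \<beta>' where "\<beta>' = inv' \<tau> \<circ> \<beta>"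
  have "\<tau> permutes {1..n}" using \<tau>_perm in_range by (auto intro: permutes_subset)
  hence "\<beta>' permutes {1..n}" unfolding \<beta>'_def using p by (intro permutes_compose permutes_inv)
  \<comment> \<open>\<open>inv' \<tau>\<close> undoes \<beta> here, because \<tau> and \<beta> agree
    on the three points.\<close>
  moreover have "\<beta>' a = a" "\<beta>' b = b" "\<beta>' c = c"
    using permutes_inverses(2)[OF \<tau>_perm] \<tau>_eq by (simp_all add: \<beta>'_def flip: \<tau>_eq)
  moreover have "refines_on \<beta>' \<alpha> C" if C: "C \<in> other_cycles" for C
  proof -
    have "\<beta>' x = \<beta> x" if "x \<in> C" for x
    proof -
      have "\<beta> x \<in> C" using o[OF C] that by (auto simp: refines_on_def)
      thus ?thesis using other_cycles_disjoint[OF C]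
          permutes_not_in[OF permutes_inv[OF \<tau>_perm], of "\<beta> x"] by (auto simp: \<beta>'_def)
    qed
    hence "refines_on \<beta>' \<alpha> C \<longleftrightarrow> refines_on \<beta> \<alpha> C" by (intro refines_on_cong refl)
    thus ?thesis using o[OF C] by simp
  qed
  ultimately have "refines n \<beta>' \<alpha>'" by (simp add: refines_\<alpha>'_iff)
  moreover have "\<beta> = \<tau> \<circ> \<beta>'"
    by (simp add: \<beta>'_def fun_eq_iff permutes_inverses[OF \<tau>_perm])
  ultimately show ?thesis using \<tau> that by blast
qed

text \<open>The product determines \<tau>: its values on the three points are those of \<tau>, which
  fixes everything else. Cancelling \<tau> then gives \<beta>.\<close>

lemma nc3_comp_inj:
  assumes "\<tau> \<in> nc3 a b c" "\<tau>' \<in> nc3 a b c" "refines n \<beta> \<alpha>'" "refines n \<beta>' \<alpha>'"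
    and eq: "\<tau> \<circ> \<beta> = \<tau>' \<circ> \<beta>'"
  shows "\<tau> = \<tau>'" "\<beta> = \<beta>'"
proof -
  have p: "\<tau> permutes {a, b, c}" "\<tau>' permutes {a, b, c}" using nc3_permutes[OF assms(1)] nc3_permutes[OF assms(2)] .
  have "\<tau> x = \<tau>' x" for x
  proof (cases "x \<in> {a, b, c}")
    case True
    hence "\<beta> x = x" "\<beta>' x = x" using assms(3,4) by (auto simp: refines_\<alpha>'_iff)
    thus ?thesis using fun_cong[OF eq, of x] by simp
  next
    case False
    thus ?thesis using p by (simp add: permutes_not_in)
  qed
  thus "\<tau> = \<tau>'" by blast
  thus "\<beta> = \<beta>'" using eq permutes_inj[OF p(1)] by (simp add: fun.inj_map_strong fun_eq_iff inj_def)
qed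

lemma sum_refines:
  fixes f :: "(nat \<Rightarrow> nat) \<Rightarrow> 'a :: comm_monoid_add"
  shows
  "(\<Sum>\<beta> | refines n \<beta> \<alpha>. f \<beta>) = (\<Sum>\<tau>\<in>nc3 a b c. \<Sum>\<beta> | refines n \<beta> \<alpha>'. f (\<tau> \<circ> \<beta>))"
proof -
  have "(\<Sum>\<tau>\<in>nc3 a b c. \<Sum>\<beta> | refines n \<beta> \<alpha>'. f (\<tau> \<circ> \<beta>))
        = (\<Sum>(\<tau>, \<beta>) \<in> nc3 a b c \<times> {\<beta>. refines n \<beta> \<alpha>'}. f (\<tau> \<circ> \<beta>))"
    by (rule sum.cartesian_product)
  also have "\<dots> = (\<Sum>\<beta> | refines n \<beta> \<alpha>. f \<beta>)"
  proof -
    have "bij_betw (\<lambda>(\<tau>, \<beta>). \<tau> \<circ> \<beta>) (nc3 a b c \<times> {\<beta>. refines n \<beta> \<alpha>'}) {\<beta>. refines n \<beta> \<alpha>}"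
      unfolding bij_betw_def
    proof
      show "inj_on (\<lambda>(\<tau>, \<beta>). \<tau> \<circ> \<beta>) (nc3 a b c \<times> {\<beta>. refines n \<beta> \<alpha>'})"
        using nc3_comp_inj by (intro inj_onI) fast
      show "(\<lambda>(\<tau>, \<beta>). \<tau> \<circ> \<beta>) ` (nc3 a b c \<times> {\<beta>. refines n \<beta> \<alpha>'}) = {\<beta>. refines n \<beta> \<alpha>}"
      proof (intro subset_antisym subsetI)
        fix \<beta> assume "\<beta> \<in> {\<beta>. refines n \<beta> \<alpha>}"
        then obtain \<tau> \<beta>' where "\<tau> \<in> nc3 a b c" "refines n \<beta>' \<alpha>'" "\<beta> = \<tau> \<circ> \<beta>'"
          using refines_imp_nc3_comp by blast
        thus "\<beta> \<in> (\<lambda>(\<tau>, \<beta>). \<tau> \<circ> \<beta>) ` (nc3 a b c \<times> {\<beta>. refines n \<beta> \<alpha>'})"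
          by (intro image_eqI[of _ _ "(\<tau>, \<beta>')"]) auto
      qed (use nc3_comp_refines in auto)
    qed
    from sum.reindex_bij_betw[OF this, of f] show ?thesis by (simp add: case_prod_unfold)
  qed
  finally show ?thesis by simp
qed

end

section \<open>Whitney polynomials\<close>

definition whitney_term :: "nat \<Rightarrow> (nat \<Rightarrow> nat) \<Rightarrow> (nat \<Rightarrow> nat) \<Rightarrow> (nat \<Rightarrow> nat) \<Rightarrow> int poly poly" where
  "whitney_term n \<sigma> \<alpha> \<beta> = var_u ^ (\<kappa> n \<sigma> \<beta> - \<kappa> n \<sigma> \<alpha>) *
     var_v ^ (\<kappa> n \<sigma> \<beta> + n - z {1..n} \<beta> - z {1..n} \<sigma>)"

context hypermap_three_cycle
begin

text \<open>Covers the refinements of \<open>\<alpha>'\<close> and \<open>\<alpha>'\<close> itself,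
  so that one set of formulas yields both the individual terms and the relation between
  \<open>\<kappa> n \<sigma> \<alpha>\<close> and
  \<open>\<kappa> n \<sigma> \<alpha>'\<close>.\<close>

definition fixing :: "(nat \<Rightarrow> nat) \<Rightarrow> bool" where
  "fixing \<beta> \<longleftrightarrow> \<beta> permutes {1..n} \<and> \<beta> a = a \<and> \<beta> b = b \<and> \<beta> c = c"

lemma fixing_\<alpha>': "fixing \<alpha>'"
  using \<alpha>'_perm \<alpha>'_apply by (simp add: fixing_def)

lemma fixing_refines: "refines n \<beta> \<alpha>' \<Longrightarrow> fixing \<beta>"
  by (simp add: refines_\<alpha>'_iff fixing_def)

lemma fixing_same_cycle:
  assumes "fixing \<beta>"
  shows "\<not> same_cycle \<beta> a b" "\<not> same_cycle \<beta> a c" "\<not> same_cycle \<beta> b c"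
proof -
  have "Orbits.orbit \<beta> a = {a}" "Orbits.orbit \<beta> b = {b}" "Orbits.orbit \<beta> c = {c}"
    using assms by (simp_all add: fixing_def orbit_eq_singleton_iff)
  thus "\<not> same_cycle \<beta> a b" "\<not> same_cycle \<beta> a c" "\<not> same_cycle \<beta> b c"
    using distinct by (simp_all add: same_cycle_def)
qed

text \<open>Fixed points lie in distinct cycles, so each transposition is a merge. The 3-cycle is
  two merges in succession, first of \<open>a\<close> with \<open>b\<close> and then of the joint
  cycle with \<open>c\<close>.\<close>

lemma fixing_\<kappa>:
  assumes "fixing \<beta>"
  shows "\<kappa> n \<sigma> \<beta> = \<kappa> n \<sigma> (transpose a b \<circ> \<beta>) + (if conn n \<sigma> \<beta> a b then 0 else 1)"
    and "\<kappa> n \<sigma> \<beta> = \<kappa> n \<sigma> (transpose a c \<circ> \<beta>) + (if conn n \<sigma> \<beta> a c then 0 else 1)"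
    and "\<kappa> n \<sigma> \<beta> = \<kappa> n \<sigma> (transpose b c \<circ> \<beta>) + (if conn n \<sigma> \<beta> b c then 0 else 1)"
    and "\<kappa> n \<sigma> \<beta> = \<kappa> n \<sigma> (transpose a c \<circ> transpose a b \<circ> \<beta>)
           + (if conn n \<sigma> \<beta> a b then 0 else 1) + (if conn n \<sigma> \<beta> a c \<or> conn n \<sigma> \<beta> b c then 0 else 1)"
    and "z {1..n} \<beta> = z {1..n} (transpose a b \<circ> \<beta>) + 1"
    and "z {1..n} \<beta> = z {1..n} (transpose a c \<circ> \<beta>) + 1"
    and "z {1..n} \<beta> = z {1..n} (transpose b c \<circ> \<beta>) + 1"
    and "z {1..n} \<beta> = z {1..n} (transpose a c \<circ> transpose a b \<circ> \<beta>) + 2"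
proof -
  have \<beta>: "\<beta> permutes {1..n}" using assms by (simp add: fixing_def)
  note ns = fixing_same_cycle[OF assms]
  note ab = \<sigma>_perm \<beta> in_range(1,2) ns(1)
  note ac = \<sigma>_perm \<beta> in_range(1,3) ns(2)
  note bc = \<sigma>_perm \<beta> in_range(2,3) ns(3)
  show k: "\<kappa> n \<sigma> \<beta> = \<kappa> n \<sigma> (transpose a b \<circ> \<beta>) + (if conn n \<sigma> \<beta> a b then 0 else 1)"
    by (rule \<kappa>_transpose_comp[OF ab])
  show "\<kappa> n \<sigma> \<beta> = \<kappa> n \<sigma> (transpose a c \<circ> \<beta>) + (if conn n \<sigma> \<beta> a c then 0 else 1)"
    by (rule \<kappa>_transpose_comp[OF ac])
  show "\<kappa> n \<sigma> \<beta> = \<kappa> n \<sigma> (transpose b c \<circ> \<beta>) + (if conn n \<sigma> \<beta> b c then 0 else 1)"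
    by (rule \<kappa>_transpose_comp[OF bc])
  show z: "z {1..n} \<beta> = z {1..n} (transpose a b \<circ> \<beta>) + 1"
    using z_transpose_comp[OF ab] by simp
  show "z {1..n} \<beta> = z {1..n} (transpose a c \<circ> \<beta>) + 1"
    using z_transpose_comp[OF ac] by simp
  show "z {1..n} \<beta> = z {1..n} (transpose b c \<circ> \<beta>) + 1"
    using z_transpose_comp[OF bc] by simp
  have "\<not> same_cycle (transpose a b \<circ> \<beta>) a c"
    using same_cycle_transpose_comp[OF ab, of a c] ns by simp
  note ac' = \<sigma>_perm transpose_comp_permutes[OF ab] in_range(1,3) this
  \<comment> \<open>After the first merge, \<open>a\<close> is connected to \<open>c\<close> as soon
    as \<open>a\<close> or \<open>b\<close> was.\<close>
  have "conn n \<sigma> (transpose a b \<circ> \<beta>) a c \<longleftrightarrow> conn n \<sigma> \<beta> a c \<or> conn n \<sigma> \<beta> b c"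
    using conn_transpose_comp[OF ab, of a c] conn_refl by blast
  thus "\<kappa> n \<sigma> \<beta> = \<kappa> n \<sigma> (transpose a c \<circ> transpose a b \<circ> \<beta>)
           + (if conn n \<sigma> \<beta> a b then 0 else 1) + (if conn n \<sigma> \<beta> a c \<or> conn n \<sigma> \<beta> b c then 0 else 1)"
    using k \<kappa>_transpose_comp[OF ac'] by (simp add: comp_assoc)
  show "z {1..n} \<beta> = z {1..n} (transpose a c \<circ> transpose a b \<circ> \<beta>) + 2"
    using z z_transpose_comp[OF ac'] by (simp add: comp_assoc)
qed

text \<open>The merge formula with the roles of \<sigma> and \<beta> exchanged. Its correction term
  is the one in \<open>fixing_\<kappa>\<close>, which is how a merge moves from \<beta> to
  \<sigma>.\<close>

lemma \<kappa>_transpose_vertex: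
  assumes "\<beta> permutes {1..n}" "i \<in> {1..n}" "j \<in> {1..n}" "\<not> same_cycle \<sigma> i j"
  shows "\<kappa> n \<sigma> \<beta> = \<kappa> n (transpose i j \<circ> \<sigma>) \<beta> + (if conn n \<sigma> \<beta> i j then 0 else 1)"
proof -
  note \<sigma>' = assms(1) \<sigma>_perm assms(2-4)
  show ?thesis
    using \<kappa>_transpose_comp[OF \<sigma>'] transpose_comp_permutes[OF \<sigma>'] \<sigma>_perm assms(1)
    by (simp add: conn_commute[of n \<sigma>] \<kappa>_commute)
qed

text \<open>Here \<open>a\<close> is merged with \<open>c\<close> first and with \<open>b\<close>
  second, so the corrections look different from those for the 3-cycle in
  \<open>fixing_\<kappa>\<close>. By transitivity both add up to the number of components lost when
  all three points are joined.\<close>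

lemma regular_vertex:
  assumes "regular \<sigma> a b c"
  shows "transpose a b \<circ> transpose a c \<circ> \<sigma> permutes {1..n}"
    and "z {1..n} \<sigma> = z {1..n} (transpose a b \<circ> transpose a c \<circ> \<sigma>) + 2"
    and "\<beta> permutes {1..n} \<Longrightarrow> \<kappa> n \<sigma> \<beta> = \<kappa> n (transpose a b \<circ> transpose a c \<circ> \<sigma>) \<beta>
       + (if conn n \<sigma> \<beta> a c then 0 else 1) + (if conn n \<sigma> \<beta> a b \<or> conn n \<sigma> \<beta> b c then 0 else 1)"
proof -
  have ns: "\<not> same_cycle \<sigma> a b" "\<not> same_cycle \<sigma> a c" "\<not> same_cycle \<sigma> b c" "\<not> same_cycle \<sigma> c b"
    using assms by (auto simp: regular_def same_cycle_def)
  note ac = \<sigma>_perm \<sigma>_perm in_range(1,3) ns(2)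
  have "\<not> same_cycle (transpose a c \<circ> \<sigma>) a b"
    using same_cycle_transpose_comp[OF ac, of a b] ns by simp
  note ab = transpose_comp_permutes[OF ac] in_range(1,2) this
  show "transpose a b \<circ> transpose a c \<circ> \<sigma> permutes {1..n}"
    using transpose_comp_permutes[OF ab(1) ab] by (simp add: comp_assoc)
  show "z {1..n} \<sigma> = z {1..n} (transpose a b \<circ> transpose a c \<circ> \<sigma>) + 2"
    using z_transpose_comp[OF ac] z_transpose_comp[OF ab(1) ab] by (simp add: comp_assoc)
  assume \<beta>: "\<beta> permutes {1..n}"
  have "conn n \<beta> (transpose a c \<circ> \<sigma>) a b \<longleftrightarrow> conn n \<sigma> \<beta> a b \<or> conn n \<sigma> \<beta> b c"
    using conn_transpose_comp[OF \<beta> ac(2-), of a b] conn_refl conn_sym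
    unfolding conn_commute[of n \<beta>] by blast
  moreover have "\<kappa> n \<beta> (transpose a b \<circ> (transpose a c \<circ> \<sigma>)) = \<kappa> n (transpose a b \<circ> (transpose a c \<circ> \<sigma>)) \<beta>"
    by (rule \<kappa>_commute[OF \<beta> transpose_comp_permutes[OF ab(1) ab]])
  ultimately show "\<kappa> n \<sigma> \<beta> = \<kappa> n (transpose a b \<circ> transpose a c \<circ> \<sigma>) \<beta>
       + (if conn n \<sigma> \<beta> a c then 0 else 1) + (if conn n \<sigma> \<beta> a b \<or> conn n \<sigma> \<beta> b c then 0 else 1)"
    using \<kappa>_transpose_comp[OF \<beta> ac(2-)] \<kappa>_transpose_comp[OF \<beta> ab]
      \<kappa>_commute[OF \<beta> \<sigma>_perm] conn_commute[of n \<beta> \<sigma>]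
    by (simp add: comp_assoc)
qed

lemma whitney_three_cycle:
  "whitney n \<sigma> \<alpha> =
     (\<Sum>\<beta> | refines n \<beta> \<alpha>'. whitney_term n \<sigma> \<alpha> \<beta>) +
     (\<Sum>\<beta> | refines n \<beta> \<alpha>'. whitney_term n \<sigma> \<alpha> (transpose a b \<circ> \<beta>)) +
     (\<Sum>\<beta> | refines n \<beta> \<alpha>'. whitney_term n \<sigma> \<alpha> (transpose a c \<circ> \<beta>)) +
     (\<Sum>\<beta> | refines n \<beta> \<alpha>'. whitney_term n \<sigma> \<alpha> (transpose b c \<circ> \<beta>)) +
     (\<Sum>\<beta> | refines n \<beta> \<alpha>'. whitney_term n \<sigma> \<alpha> (transpose a c \<circ> transpose a b \<circ> \<beta>))"
proof -
  have "whitney n \<sigma> \<alpha> = (\<Sum>\<beta> | refines n \<beta> \<alpha>. whitney_term n \<sigma> \<alpha> \<beta>)"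
    by (simp add: whitney_def whitney_term_def)
  also have "\<dots> = (\<Sum>\<tau>\<in>nc3 a b c. \<Sum>\<beta> | refines n \<beta> \<alpha>'. whitney_term n \<sigma> \<alpha> (\<tau> \<circ> \<beta>))"
    by (rule sum_refines)
  finally show ?thesis using distinct by (simp add: sum_nc3)
qed

text \<open>Evaluates each of the five sums: \<open>p\<close> and \<open>q\<close> are the constant
  shifts of the two exponents between the term of \<open>f \<beta>\<close> and that of \<beta>. Both
  conditions are written additively to avoid truncated subtraction.\<close>

lemma sum_whitney_term:
  assumes \<sigma>': "\<sigma>' permutes {1..n}"
    and k: "\<And>\<beta>. refines n \<beta> \<alpha>' \<Longrightarrow> \<kappa> n \<sigma> (f \<beta>) + \<kappa> n \<sigma>' \<alpha>' = \<kappa> n \<sigma>' \<beta> + \<kappa> n \<sigma> \<alpha> + p"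
    and z: "\<And>\<beta>. refines n \<beta> \<alpha>' \<Longrightarrow>
      \<kappa> n \<sigma> (f \<beta>) + z {1..n} \<sigma>' + z {1..n} \<beta> = \<kappa> n \<sigma>' \<beta> + z {1..n} (f \<beta>) + z {1..n} \<sigma> + q"
  shows "(\<Sum>\<beta> | refines n \<beta> \<alpha>'. whitney_term n \<sigma> \<alpha> (f \<beta>)) = var_u ^ p * var_v ^ q * whitney n \<sigma>' \<alpha>'"
proof -
  have "whitney_term n \<sigma> \<alpha> (f \<beta>) = var_u ^ p * var_v ^ q * whitney_term n \<sigma>' \<alpha>' \<beta>"
    if \<beta>: "refines n \<beta> \<alpha>'" for \<beta>
  proof -
    have "\<beta> permutes {1..n}" using \<beta> by (simp add: refines_def)
    \<comment> \<open>With these bounds the subtractions on the right are exact, so the additive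
      conditions give the exponents.\<close>
    note le = \<kappa>_refines_mono[OF \<beta> \<alpha>'_perm \<sigma>'] z_add_z_le[OF \<sigma>' this]
    have "\<kappa> n \<sigma> (f \<beta>) - \<kappa> n \<sigma> \<alpha> = p + (\<kappa> n \<sigma>' \<beta> - \<kappa> n \<sigma>' \<alpha>')"
      using k[OF \<beta>] le by linarith
    moreover have "\<kappa> n \<sigma> (f \<beta>) + n - z {1..n} (f \<beta>) - z {1..n} \<sigma>
        = q + (\<kappa> n \<sigma>' \<beta> + n - z {1..n} \<beta> - z {1..n} \<sigma>')"
      using z[OF \<beta>] le by linarith
    ultimately show ?thesis by (simp add: whitney_term_def power_add mult_ac)
  qed
  hence "(\<Sum>\<beta> | refines n \<beta> \<alpha>'. whitney_term n \<sigma> \<alpha> (f \<beta>))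
      = (\<Sum>\<beta> | refines n \<beta> \<alpha>'. var_u ^ p * var_v ^ q * whitney_term n \<sigma>' \<alpha>' \<beta>)"
    by (intro sum.cong) auto
  thus ?thesis by (simp add: whitney_def whitney_term_def sum_distrib_left)
qed

lemma z_comp_refines:
  assumes "refines n \<beta> \<alpha>'"
  shows "z {1..n} \<beta> = z {1..n} (transpose a b \<circ> \<beta>) + 1 \<and>
    z {1..n} \<beta> = z {1..n} (transpose a c \<circ> \<beta>) + 1 \<and>
    z {1..n} \<beta> = z {1..n} (transpose b c \<circ> \<beta>) + 1 \<and>
    z {1..n} \<beta> = z {1..n} (transpose a c \<circ> transpose a b \<circ> \<beta>) + 2"
  using fixing_\<kappa>(5-8)[OF fixing_refines[OF assms]] by blast

text \<open>The two corrections classify the 3-cycle: both are 1 for a double bridge, exactly one is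
  1 for a single bridge, and both vanish in the ordinary case.\<close>

lemma \<kappa>_\<alpha>:
  "\<kappa> n \<sigma> \<alpha>' = \<kappa> n \<sigma> \<alpha> + (if conn n \<sigma> \<alpha>' a b then 0 else 1)
     + (if conn n \<sigma> \<alpha>' a c \<or> conn n \<sigma> \<alpha>' b c then 0 else 1)"
  using fixing_\<kappa>(4)[OF fixing_\<alpha>'] by (simp only: \<alpha>_eq[symmetric])

lemma conn_equiv:
  "conn n \<sigma> \<beta> a b \<Longrightarrow> conn n \<sigma> \<beta> a c \<longleftrightarrow> conn n \<sigma> \<beta> b c"
  "conn n \<sigma> \<beta> a c \<Longrightarrow> conn n \<sigma> \<beta> a b \<longleftrightarrow> conn n \<sigma> \<beta> b c"
  using conn_sym conn_trans by blast+

lemma not_conn_refines: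
  "refines n \<beta> \<alpha>' \<Longrightarrow> \<not> conn n \<sigma> \<alpha>' x y \<Longrightarrow> \<not> conn n \<sigma> \<beta> x y"
  using conn_refines_mono[OF _ \<alpha>'_perm] by blast

lemma not_conn_not_same_cycle: "\<not> conn n \<sigma> \<beta> x y \<Longrightarrow> \<not> same_cycle \<sigma> x y"
  using conn_of_same_cycle[OF \<sigma>_perm] by blast

lemma transpose_vertex:
  assumes "i \<in> {1..n}" "j \<in> {1..n}" "\<not> same_cycle \<sigma> i j"
  shows "transpose i j \<circ> \<sigma> permutes {1..n}" "z {1..n} \<sigma> = z {1..n} (transpose i j \<circ> \<sigma>) + 1"
  using transpose_comp_permutes[OF \<sigma>_perm \<sigma>_perm assms] z_transpose_comp[OF \<sigma>_perm \<sigma>_perm assms]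
  by simp_all

section \<open>The six kinds of 3-cycles\<close>

lemma whitney_double_loop:
  assumes "double_loop \<sigma> a b c"
  shows "whitney n \<sigma> \<alpha> = (1 + 3 * var_v + var_v ^ 2) * whitney n \<sigma> \<alpha>'"
proof -
  have c: "conn n \<sigma> \<beta> a b" "conn n \<sigma> \<beta> a c" "conn n \<sigma> \<beta> b c" for \<beta>
    using assms by (auto simp: double_loop_def same_cycle_def intro!: conn_of_same_cycle[OF \<sigma>_perm])
  have A: "\<kappa> n \<sigma> \<alpha>' = \<kappa> n \<sigma> \<alpha>" using \<kappa>_\<alpha> c by simp
  \<comment> \<open>The points share a vertex, so no merge in \<beta> changes \<kappa>. Each merge
    still removes a cycle of \<beta>, which contributes a factor \<open>var_v\<close>.\<close>
  have K: "\<kappa> n \<sigma> (transpose a b \<circ> \<beta>) = \<kappa> n \<sigma> \<beta> \<and>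
      \<kappa> n \<sigma> (transpose a c \<circ> \<beta>) = \<kappa> n \<sigma> \<beta> \<and>
      \<kappa> n \<sigma> (transpose b c \<circ> \<beta>) = \<kappa> n \<sigma> \<beta> \<and>
      \<kappa> n \<sigma> (transpose a c \<circ> transpose a b \<circ> \<beta>) = \<kappa> n \<sigma> \<beta>"
    if "refines n \<beta> \<alpha>'" for \<beta>
    using fixing_\<kappa>(1-4)[OF fixing_refines[OF that]] c by simp
  have id: "(\<Sum>\<beta> | refines n \<beta> \<alpha>'. whitney_term n \<sigma> \<alpha> \<beta>) =
      var_u ^ 0 * var_v ^ 0 * whitney n \<sigma> \<alpha>'"
    by (rule sum_whitney_term[OF \<sigma>_perm]; frule K; drule z_comp_refines; use A  in linarith)
  have ab: "(\<Sum>\<beta> | refines n \<beta> \<alpha>'. whitney_term n \<sigma> \<alpha> (transpose a b \<circ> \<beta>)) =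
      var_u ^ 0 * var_v ^ 1 * whitney n \<sigma> \<alpha>'"
    by (rule sum_whitney_term[OF \<sigma>_perm]; frule K; drule z_comp_refines; use A  in linarith)
  have ac: "(\<Sum>\<beta> | refines n \<beta> \<alpha>'. whitney_term n \<sigma> \<alpha> (transpose a c \<circ> \<beta>)) =
      var_u ^ 0 * var_v ^ 1 * whitney n \<sigma> \<alpha>'"
    by (rule sum_whitney_term[OF \<sigma>_perm]; frule K; drule z_comp_refines; use A  in linarith)
  have bc: "(\<Sum>\<beta> | refines n \<beta> \<alpha>'. whitney_term n \<sigma> \<alpha> (transpose b c \<circ> \<beta>)) =
      var_u ^ 0 * var_v ^ 1 * whitney n \<sigma> \<alpha>'"
    by (rule sum_whitney_term[OF \<sigma>_perm]; frule K; drule z_comp_refines; use A  in linarith)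
  have comp: "(\<Sum>\<beta> | refines n \<beta> \<alpha>'. whitney_term n \<sigma> \<alpha> (transpose a c \<circ> transpose a b \<circ> \<beta>)) =
      var_u ^ 0 * var_v ^ 2 * whitney n \<sigma> \<alpha>'"
    by (rule sum_whitney_term[OF \<sigma>_perm]; frule K; drule z_comp_refines; use A  in linarith)
  show ?thesis unfolding whitney_three_cycle id ab ac bc comp
    by (simp add: algebra_simps power2_eq_square)
qed

text \<open>No two of the points are connected for any \<beta>, so every merge in \<beta> lowers
  \<kappa> and the cycle count together and leaves the exponent of \<open>var_v\<close> alone.
  Relative to the fully merged vertex, the number of merges still missing is the exponent of
  \<open>var_u\<close>.\<close>

lemma whitney_double_bridge:
  assumes "double_bridge n \<sigma> \<alpha> a b c"
  shows "whitney n \<sigma> \<alpha> =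
    (1 + 3 * var_u + var_u ^ 2) * whitney n (transpose a b \<circ> transpose a c \<circ> \<sigma>) \<alpha>'"
proof -
  have A0: "\<kappa> n \<sigma> \<alpha>' = \<kappa> n \<sigma> \<alpha> + 2" using assms by (simp add: double_bridge_def)
  hence c: "\<not> conn n \<sigma> \<alpha>' a b" "\<not> conn n \<sigma> \<alpha>' a c" "\<not> conn n \<sigma> \<alpha>' b c"
    using \<kappa>_\<alpha> by (auto split: if_splits)
  hence "regular \<sigma> a b c" using not_conn_not_same_cycle by (simp add: regular_def)
  note reg = regular_vertex[OF this]
  have A: "\<kappa> n \<sigma> \<alpha>' = \<kappa> n \<sigma> \<alpha> + 2"
    "\<kappa> n \<sigma> \<alpha>' = \<kappa> n (transpose a b \<circ> transpose a c \<circ> \<sigma>) \<alpha>' + 2"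
    using A0 reg(3)[OF \<alpha>'_perm] c by simp_all
  have K: "\<kappa> n \<sigma> \<beta> = \<kappa> n \<sigma> (transpose a b \<circ> \<beta>) + 1 \<and>
      \<kappa> n \<sigma> \<beta> = \<kappa> n \<sigma> (transpose a c \<circ> \<beta>) + 1 \<and>
      \<kappa> n \<sigma> \<beta> = \<kappa> n \<sigma> (transpose b c \<circ> \<beta>) + 1 \<and>
      \<kappa> n \<sigma> \<beta> = \<kappa> n \<sigma> (transpose a c \<circ> transpose a b \<circ> \<beta>) + 2 \<and>
      \<kappa> n \<sigma> \<beta> = \<kappa> n (transpose a b \<circ> transpose a c \<circ> \<sigma>) \<beta> + 2"
    if "refines n \<beta> \<alpha>'" for \<beta>
    using fixing_\<kappa>(1-4)[OF fixing_refines[OF that]] c[THEN not_conn_refines[OF that]]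
      reg(3)[OF fixing_refines[OF that, unfolded fixing_def, THEN conjunct1]] by simp
  have id: "(\<Sum>\<beta> | refines n \<beta> \<alpha>'. whitney_term n \<sigma> \<alpha> \<beta>) =
      var_u ^ 2 * var_v ^ 0 * whitney n (transpose a b \<circ> transpose a c \<circ> \<sigma>) \<alpha>'"
    by (rule sum_whitney_term[OF reg(1)]; frule K; drule z_comp_refines; use A reg(2) in linarith)
  have ab: "(\<Sum>\<beta> | refines n \<beta> \<alpha>'. whitney_term n \<sigma> \<alpha> (transpose a b \<circ> \<beta>)) =
      var_u ^ 1 * var_v ^ 0 * whitney n (transpose a b \<circ> transpose a c \<circ> \<sigma>) \<alpha>'"
    by (rule sum_whitney_term[OF reg(1)]; frule K; drule z_comp_refines; use A reg(2) in linarith)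
  have ac: "(\<Sum>\<beta> | refines n \<beta> \<alpha>'. whitney_term n \<sigma> \<alpha> (transpose a c \<circ> \<beta>)) =
      var_u ^ 1 * var_v ^ 0 * whitney n (transpose a b \<circ> transpose a c \<circ> \<sigma>) \<alpha>'"
    by (rule sum_whitney_term[OF reg(1)]; frule K; drule z_comp_refines; use A reg(2) in linarith)
  have bc: "(\<Sum>\<beta> | refines n \<beta> \<alpha>'. whitney_term n \<sigma> \<alpha> (transpose b c \<circ> \<beta>)) =
      var_u ^ 1 * var_v ^ 0 * whitney n (transpose a b \<circ> transpose a c \<circ> \<sigma>) \<alpha>'"
    by (rule sum_whitney_term[OF reg(1)]; frule K; drule z_comp_refines; use A reg(2) in linarith)
  have comp: "(\<Sum>\<beta> | refines n \<beta> \<alpha>'. whitney_term n \<sigma> \<alpha> (transpose a c \<circ> transpose a b \<circ> \<beta>)) =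
      var_u ^ 0 * var_v ^ 0 * whitney n (transpose a b \<circ> transpose a c \<circ> \<sigma>) \<alpha>'"
    by (rule sum_whitney_term[OF reg(1)]; frule K; drule z_comp_refines; use A reg(2) in linarith)
  show ?thesis unfolding whitney_three_cycle id ab ac bc comp
    by (simp add: algebra_simps power2_eq_square)
qed

text \<open>Merging \<open>a\<close> and \<open>b\<close> in \<beta> costs no component and gives a
  factor \<open>var_v\<close>. Thus the identity and the transposition of \<open>a\<close> and
  \<open>b\<close> pair up over \<sigma>, and likewise the transposition of \<open>b\<close> and
  \<open>c\<close> and the 3-cycle over the merged vertex; the last transposition stands
  alone.\<close>

lemma whitney_simple_loop:
  assumes "simple_loop n \<sigma> \<alpha> a b c" "same_cycle \<sigma> a b"
  shows "whitney n \<sigma> \<alpha> =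
    (1 + var_v) * (whitney n (transpose b c \<circ> \<sigma>) \<alpha>' + whitney n \<sigma> \<alpha>')
    + whitney n (transpose a c \<circ> \<sigma>) \<alpha>'"
proof -
  have sc: "same_cycle \<sigma> a b" "\<not> same_cycle \<sigma> a c" "\<not> same_cycle \<sigma> b c"
    using assms by (auto simp: simple_loop_def bridge_loop_def single_loop_def same_cycle_def)
  note ac_v = transpose_vertex[OF in_range(1,3) sc(2)]
  note bc_v = transpose_vertex[OF in_range(2,3) sc(3)]
  note ac_k = \<kappa>_transpose_vertex[OF _ in_range(1,3) sc(2)]
  note bc_k = \<kappa>_transpose_vertex[OF _ in_range(2,3) sc(3)]
  have c: "conn n \<sigma> \<beta> a b" for \<beta> using sc(1) by (rule conn_of_same_cycle[OF \<sigma>_perm])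
  have A0: "\<kappa> n \<sigma> \<alpha>' = \<kappa> n \<sigma> \<alpha>" using assms by (simp add: simple_loop_def ordinary_def)
  \<comment> \<open>The second correction in \<open>\<kappa>_\<alpha>\<close> vanishes, so
    \<open>c\<close> is connected to \<open>a\<close> or \<open>b\<close>, and then to both.\<close>
  hence "conn n \<sigma> \<alpha>' a c" "conn n \<sigma> \<alpha>' b c"
    using \<kappa>_\<alpha> conn_equiv[of \<alpha>'] c by (auto split: if_splits)
  hence A: "\<kappa> n \<sigma> \<alpha>' = \<kappa> n \<sigma> \<alpha>" "\<kappa> n (transpose a c \<circ> \<sigma>) \<alpha>' = \<kappa> n \<sigma> \<alpha>"
    "\<kappa> n (transpose b c \<circ> \<sigma>) \<alpha>' = \<kappa> n \<sigma> \<alpha>"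
    using A0 ac_k[OF \<alpha>'_perm] bc_k[OF \<alpha>'_perm] by simp_all
  have K: "\<kappa> n \<sigma> (transpose a b \<circ> \<beta>) = \<kappa> n \<sigma> \<beta> \<and>
      \<kappa> n \<sigma> (transpose a c \<circ> \<beta>) = \<kappa> n (transpose a c \<circ> \<sigma>) \<beta> \<and>
      \<kappa> n \<sigma> (transpose b c \<circ> \<beta>) = \<kappa> n (transpose b c \<circ> \<sigma>) \<beta> \<and>
      \<kappa> n \<sigma> (transpose a c \<circ> transpose a b \<circ> \<beta>) = \<kappa> n (transpose b c \<circ> \<sigma>) \<beta>"
    if "refines n \<beta> \<alpha>'" for \<beta>
    using fixing_\<kappa>(1-4)[OF fixing_refines[OF that]] c conn_equiv(1)[OF c, of \<beta>]
      ac_k[OF fixing_refines[OF that, unfolded fixing_def, THEN conjunct1]]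
      bc_k[OF fixing_refines[OF that, unfolded fixing_def, THEN conjunct1]] by (simp split: if_splits)
  have id: "(\<Sum>\<beta> | refines n \<beta> \<alpha>'. whitney_term n \<sigma> \<alpha> \<beta>) =
      var_u ^ 0 * var_v ^ 0 * whitney n \<sigma> \<alpha>'"
    by (rule sum_whitney_term[OF \<sigma>_perm]; frule K; drule z_comp_refines; use A  in linarith)
  have ab: "(\<Sum>\<beta> | refines n \<beta> \<alpha>'. whitney_term n \<sigma> \<alpha> (transpose a b \<circ> \<beta>)) =
      var_u ^ 0 * var_v ^ 1 * whitney n \<sigma> \<alpha>'"
    by (rule sum_whitney_term[OF \<sigma>_perm]; frule K; drule z_comp_refines; use A  in linarith)
  have ac: "(\<Sum>\<beta> | refines n \<beta> \<alpha>'. whitney_term n \<sigma> \<alpha> (transpose a c \<circ> \<beta>)) =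
      var_u ^ 0 * var_v ^ 0 * whitney n (transpose a c \<circ> \<sigma>) \<alpha>'"
    by (rule sum_whitney_term[OF ac_v(1)]; frule K; drule z_comp_refines; use A ac_v(2) in linarith)
  have bc: "(\<Sum>\<beta> | refines n \<beta> \<alpha>'. whitney_term n \<sigma> \<alpha> (transpose b c \<circ> \<beta>)) =
      var_u ^ 0 * var_v ^ 0 * whitney n (transpose b c \<circ> \<sigma>) \<alpha>'"
    by (rule sum_whitney_term[OF bc_v(1)]; frule K; drule z_comp_refines; use A bc_v(2) in linarith)
  have comp: "(\<Sum>\<beta> | refines n \<beta> \<alpha>'. whitney_term n \<sigma> \<alpha> (transpose a c \<circ> transpose a b \<circ> \<beta>)) =
      var_u ^ 0 * var_v ^ 1 * whitney n (transpose b c \<circ> \<sigma>) \<alpha>'"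
    by (rule sum_whitney_term[OF bc_v(1)]; frule K; drule z_comp_refines; use A bc_v(2) in linarith)
  show ?thesis unfolding whitney_three_cycle id ab ac bc comp
    by (simp add: algebra_simps power2_eq_square)
qed

text \<open>\<open>c\<close> is unconnected to \<open>a\<close> and \<open>b\<close> for every
  \<beta>, while \<open>a\<close> and \<open>b\<close> are connected by \<open>\<alpha>'\<close> but
  not necessarily by \<beta>. A factor \<open>var_u\<close> appears in the two terms, identity and
  transposition of \<open>a\<close> and \<open>b\<close>, that do not attach
  \<open>c\<close>.\<close>

lemma whitney_simple_bridge:
  assumes "simple_bridge n \<sigma> \<alpha> a b c" "\<kappa> n \<sigma> (\<alpha> \<circ> transpose b c) = \<kappa> n \<sigma> \<alpha> + 1"
  shows "whitney n \<sigma> \<alpha> =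
    (1 + var_u) * (whitney n (transpose b c \<circ> \<sigma>) \<alpha>'
                   + whitney n (transpose a b \<circ> transpose a c \<circ> \<sigma>) \<alpha>')
    + whitney n (transpose a c \<circ> \<sigma>) \<alpha>'"
proof -
  have r: "regular \<sigma> a b c" and A0: "\<kappa> n \<sigma> \<alpha>' = \<kappa> n \<sigma> \<alpha> + 1"
    using assms(1) by (simp_all add: simple_bridge_def single_bridge_def)
  hence sc: "\<not> same_cycle \<sigma> a c" "\<not> same_cycle \<sigma> b c" by (simp_all add: regular_def)
  note reg = regular_vertex[OF r]
  note ac_v = transpose_vertex[OF in_range(1,3) sc(1)]
  note bc_v = transpose_vertex[OF in_range(2,3) sc(2)]
  note ac_k = \<kappa>_transpose_vertex[OF _ in_range(1,3) sc(1)]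
  note bc_k = \<kappa>_transpose_vertex[OF _ in_range(2,3) sc(2)]
  have c: "conn n \<sigma> \<alpha>' a b"
    \<comment> \<open>The merge of \<open>a\<close> and \<open>b\<close> in \<open>\<alpha>'\<close>
      leaves \<kappa> unchanged, so the two points were connected before it.\<close>
    using assms(2) A0 fixing_\<kappa>(1)[OF fixing_\<alpha>'] by (simp add: \<alpha>_comp_transpose split: if_splits)
  hence nc: "\<not> conn n \<sigma> \<alpha>' a c" "\<not> conn n \<sigma> \<alpha>' b c"
    using \<kappa>_\<alpha> A0 by (auto split: if_splits)
  have A: "\<kappa> n \<sigma> \<alpha>' = \<kappa> n \<sigma> \<alpha> + 1" "\<kappa> n (transpose a c \<circ> \<sigma>) \<alpha>' = \<kappa> n \<sigma> \<alpha>"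
    "\<kappa> n (transpose b c \<circ> \<sigma>) \<alpha>' = \<kappa> n \<sigma> \<alpha>"
    "\<kappa> n (transpose a b \<circ> transpose a c \<circ> \<sigma>) \<alpha>' = \<kappa> n \<sigma> \<alpha>"
    using A0 ac_k[OF \<alpha>'_perm] bc_k[OF \<alpha>'_perm] reg(3)[OF \<alpha>'_perm] c nc by simp_all
  \<comment> \<open>Whether \<beta> connects \<open>a\<close> and \<open>b\<close> is left open.
    Where that correction enters, it occurs on both sides and cancels.\<close>
  have K: "\<kappa> n \<sigma> \<beta> = \<kappa> n (transpose b c \<circ> \<sigma>) \<beta> + 1 \<and>
      \<kappa> n \<sigma> (transpose a b \<circ> \<beta>) = \<kappa> n (transpose a b \<circ> transpose a c \<circ> \<sigma>) \<beta> + 1 \<and>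
      \<kappa> n \<sigma> (transpose a c \<circ> \<beta>) = \<kappa> n (transpose a c \<circ> \<sigma>) \<beta> \<and>
      \<kappa> n \<sigma> (transpose b c \<circ> \<beta>) = \<kappa> n (transpose b c \<circ> \<sigma>) \<beta> \<and>
      \<kappa> n \<sigma> (transpose a c \<circ> transpose a b \<circ> \<beta>) = \<kappa> n (transpose a b \<circ> transpose a c \<circ> \<sigma>) \<beta>"
    if "refines n \<beta> \<alpha>'" for \<beta>
    using fixing_\<kappa>(1-4)[OF fixing_refines[OF that]] nc[THEN not_conn_refines[OF that]]
      ac_k[OF fixing_refines[OF that, unfolded fixing_def, THEN conjunct1]]
      bc_k[OF fixing_refines[OF that, unfolded fixing_def, THEN conjunct1]]
      reg(3)[OF fixing_refines[OF that, unfolded fixing_def, THEN conjunct1]] by (simp split: if_splits)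
  have id: "(\<Sum>\<beta> | refines n \<beta> \<alpha>'. whitney_term n \<sigma> \<alpha> \<beta>) =
      var_u ^ 1 * var_v ^ 0 * whitney n (transpose b c \<circ> \<sigma>) \<alpha>'"
    by (rule sum_whitney_term[OF bc_v(1)]; frule K; drule z_comp_refines; use A bc_v(2) in linarith)
  have ab: "(\<Sum>\<beta> | refines n \<beta> \<alpha>'. whitney_term n \<sigma> \<alpha> (transpose a b \<circ> \<beta>)) =
      var_u ^ 1 * var_v ^ 0 * whitney n (transpose a b \<circ> transpose a c \<circ> \<sigma>) \<alpha>'"
    by (rule sum_whitney_term[OF reg(1)]; frule K; drule z_comp_refines; use A reg(2) in linarith)
  have ac: "(\<Sum>\<beta> | refines n \<beta> \<alpha>'. whitney_term n \<sigma> \<alpha> (transpose a c \<circ> \<beta>)) =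
      var_u ^ 0 * var_v ^ 0 * whitney n (transpose a c \<circ> \<sigma>) \<alpha>'"
    by (rule sum_whitney_term[OF ac_v(1)]; frule K; drule z_comp_refines; use A ac_v(2) in linarith)
  have bc: "(\<Sum>\<beta> | refines n \<beta> \<alpha>'. whitney_term n \<sigma> \<alpha> (transpose b c \<circ> \<beta>)) =
      var_u ^ 0 * var_v ^ 0 * whitney n (transpose b c \<circ> \<sigma>) \<alpha>'"
    by (rule sum_whitney_term[OF bc_v(1)]; frule K; drule z_comp_refines; use A bc_v(2) in linarith)
  have comp: "(\<Sum>\<beta> | refines n \<beta> \<alpha>'. whitney_term n \<sigma> \<alpha> (transpose a c \<circ> transpose a b \<circ> \<beta>)) =
      var_u ^ 0 * var_v ^ 0 * whitney n (transpose a b \<circ> transpose a c \<circ> \<sigma>) \<alpha>'"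
    by (rule sum_whitney_term[OF reg(1)]; frule K; drule z_comp_refines; use A reg(2) in linarith)
  show ?thesis unfolding whitney_three_cycle id ab ac bc comp
    by (simp add: algebra_simps power2_eq_square)
qed

text \<open>Two independent effects: leaving \<open>c\<close> unattached gives \<open>var_u\<close>,
  and merging \<open>a\<close> with \<open>b\<close> inside their common vertex gives
  \<open>var_v\<close>. Over the vertex merged by \<open>b\<close> and \<open>c\<close>, the
  identity, two transpositions and the 3-cycle realize all four combinations.\<close>

lemma whitney_bridge_loop:
  assumes "bridge_loop n \<sigma> \<alpha> a b c" "same_cycle \<sigma> a b"
  shows "whitney n \<sigma> \<alpha> =
    (1 + var_u) * (1 + var_v) * whitney n (transpose b c \<circ> \<sigma>) \<alpha>'
    + whitney n (transpose a c \<circ> \<sigma>) \<alpha>'"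
proof -
  have sc: "same_cycle \<sigma> a b" "\<not> same_cycle \<sigma> a c" "\<not> same_cycle \<sigma> b c"
    using assms by (auto simp: simple_loop_def bridge_loop_def single_loop_def same_cycle_def)
  note ac_v = transpose_vertex[OF in_range(1,3) sc(2)]
  note bc_v = transpose_vertex[OF in_range(2,3) sc(3)]
  note ac_k = \<kappa>_transpose_vertex[OF _ in_range(1,3) sc(2)]
  note bc_k = \<kappa>_transpose_vertex[OF _ in_range(2,3) sc(3)]
  have c: "conn n \<sigma> \<beta> a b" for \<beta> using sc(1) by (rule conn_of_same_cycle[OF \<sigma>_perm])
  have A0: "\<kappa> n \<sigma> \<alpha>' = \<kappa> n \<sigma> \<alpha> + 1" using assms by (simp add: bridge_loop_def single_bridge_def)
  hence nc: "\<not> conn n \<sigma> \<alpha>' a c" "\<not> conn n \<sigma> \<alpha>' b c"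
    using \<kappa>_\<alpha> c by (auto split: if_splits)
  hence A: "\<kappa> n (transpose a c \<circ> \<sigma>) \<alpha>' = \<kappa> n \<sigma> \<alpha>" "\<kappa> n (transpose b c \<circ> \<sigma>) \<alpha>' = \<kappa> n \<sigma> \<alpha>"
    using A0 ac_k[OF \<alpha>'_perm] bc_k[OF \<alpha>'_perm] by simp_all
  have K: "\<kappa> n \<sigma> \<beta> = \<kappa> n (transpose b c \<circ> \<sigma>) \<beta> + 1 \<and>
      \<kappa> n \<sigma> (transpose a b \<circ> \<beta>) = \<kappa> n (transpose b c \<circ> \<sigma>) \<beta> + 1 \<and>
      \<kappa> n \<sigma> (transpose a c \<circ> \<beta>) = \<kappa> n (transpose a c \<circ> \<sigma>) \<beta> \<and>
      \<kappa> n \<sigma> (transpose b c \<circ> \<beta>) = \<kappa> n (transpose b c \<circ> \<sigma>) \<beta> \<and>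
      \<kappa> n \<sigma> (transpose a c \<circ> transpose a b \<circ> \<beta>) = \<kappa> n (transpose b c \<circ> \<sigma>) \<beta>"
    if "refines n \<beta> \<alpha>'" for \<beta>
    using fixing_\<kappa>(1-4)[OF fixing_refines[OF that]] c nc[THEN not_conn_refines[OF that]]
      ac_k[OF fixing_refines[OF that, unfolded fixing_def, THEN conjunct1]]
      bc_k[OF fixing_refines[OF that, unfolded fixing_def, THEN conjunct1]] by simp
  have id: "(\<Sum>\<beta> | refines n \<beta> \<alpha>'. whitney_term n \<sigma> \<alpha> \<beta>) =
      var_u ^ 1 * var_v ^ 0 * whitney n (transpose b c \<circ> \<sigma>) \<alpha>'"
    by (rule sum_whitney_term[OF bc_v(1)]; frule K; drule z_comp_refines; use A bc_v(2) in linarith)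
  have ab: "(\<Sum>\<beta> | refines n \<beta> \<alpha>'. whitney_term n \<sigma> \<alpha> (transpose a b \<circ> \<beta>)) =
      var_u ^ 1 * var_v ^ 1 * whitney n (transpose b c \<circ> \<sigma>) \<alpha>'"
    by (rule sum_whitney_term[OF bc_v(1)]; frule K; drule z_comp_refines; use A bc_v(2) in linarith)
  have ac: "(\<Sum>\<beta> | refines n \<beta> \<alpha>'. whitney_term n \<sigma> \<alpha> (transpose a c \<circ> \<beta>)) =
      var_u ^ 0 * var_v ^ 0 * whitney n (transpose a c \<circ> \<sigma>) \<alpha>'"
    by (rule sum_whitney_term[OF ac_v(1)]; frule K; drule z_comp_refines; use A ac_v(2) in linarith)
  have bc: "(\<Sum>\<beta> | refines n \<beta> \<alpha>'. whitney_term n \<sigma> \<alpha> (transpose b c \<circ> \<beta>)) =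
      var_u ^ 0 * var_v ^ 0 * whitney n (transpose b c \<circ> \<sigma>) \<alpha>'"
    by (rule sum_whitney_term[OF bc_v(1)]; frule K; drule z_comp_refines; use A bc_v(2) in linarith)
  have comp: "(\<Sum>\<beta> | refines n \<beta> \<alpha>'. whitney_term n \<sigma> \<alpha> (transpose a c \<circ> transpose a b \<circ> \<beta>)) =
      var_u ^ 0 * var_v ^ 1 * whitney n (transpose b c \<circ> \<sigma>) \<alpha>'"
    by (rule sum_whitney_term[OF bc_v(1)]; frule K; drule z_comp_refines; use A bc_v(2) in linarith)
  show ?thesis unfolding whitney_three_cycle id ab ac bc comp
    by (simp add: algebra_simps power2_eq_square)
qed

text \<open>Every merge in \<beta> is matched by a merge of the same points in \<sigma>, with equal
  \<kappa> and equal loss of cycles. All these merges keep \<kappa> with \<open>\<alpha>'\<close>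
  fixed, so no power of \<open>var_u\<close> or \<open>var_v\<close> arises.\<close>

lemma whitney_ordinary_regular:
  assumes "ordinary_regular n \<sigma> \<alpha> a b c"
  shows "whitney n \<sigma> \<alpha> =
    whitney n \<sigma> \<alpha>' + whitney n (transpose b c \<circ> \<sigma>) \<alpha>' + whitney n (transpose a b \<circ> \<sigma>) \<alpha>'
    + whitney n (transpose a b \<circ> transpose a c \<circ> \<sigma>) \<alpha>' + whitney n (transpose a c \<circ> \<sigma>) \<alpha>'"
proof -
  have r: "regular \<sigma> a b c" and A0: "\<kappa> n \<sigma> \<alpha>' = \<kappa> n \<sigma> \<alpha>"
    using assms by (simp_all add: ordinary_regular_def ordinary_def)
  hence sc: "\<not> same_cycle \<sigma> a b" "\<not> same_cycle \<sigma> a c" "\<not> same_cycle \<sigma> b c"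
    by (simp_all add: regular_def)
  note reg = regular_vertex[OF r]
  note ab_v = transpose_vertex[OF in_range(1,2) sc(1)]
  note ac_v = transpose_vertex[OF in_range(1,3) sc(2)]
  note bc_v = transpose_vertex[OF in_range(2,3) sc(3)]
  note ab_k = \<kappa>_transpose_vertex[OF _ in_range(1,2) sc(1)]
  note ac_k = \<kappa>_transpose_vertex[OF _ in_range(1,3) sc(2)]
  note bc_k = \<kappa>_transpose_vertex[OF _ in_range(2,3) sc(3)]
  have "conn n \<sigma> \<alpha>' a b" "conn n \<sigma> \<alpha>' a c" "conn n \<sigma> \<alpha>' b c"
    using \<kappa>_\<alpha> A0 conn_equiv[of \<alpha>'] by (auto split: if_splits)
  hence A: "\<kappa> n \<sigma> \<alpha>' = \<kappa> n \<sigma> \<alpha>" "\<kappa> n (transpose a b \<circ> \<sigma>) \<alpha>' = \<kappa> n \<sigma> \<alpha>"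
    "\<kappa> n (transpose a c \<circ> \<sigma>) \<alpha>' = \<kappa> n \<sigma> \<alpha>" "\<kappa> n (transpose b c \<circ> \<sigma>) \<alpha>' = \<kappa> n \<sigma> \<alpha>"
    "\<kappa> n (transpose a b \<circ> transpose a c \<circ> \<sigma>) \<alpha>' = \<kappa> n \<sigma> \<alpha>"
    using A0 ab_k[OF \<alpha>'_perm] ac_k[OF \<alpha>'_perm] bc_k[OF \<alpha>'_perm] reg(3)[OF \<alpha>'_perm] by simp_all
  \<comment> \<open>\<beta> may connect any of the three points or none. The corrections for the
    3-cycle and for the merged vertex agree in each configuration by
    \<open>conn_equiv\<close>.\<close>
  have K: "\<kappa> n \<sigma> (transpose a b \<circ> \<beta>) = \<kappa> n (transpose a b \<circ> \<sigma>) \<beta> \<and>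
      \<kappa> n \<sigma> (transpose a c \<circ> \<beta>) = \<kappa> n (transpose a c \<circ> \<sigma>) \<beta> \<and>
      \<kappa> n \<sigma> (transpose b c \<circ> \<beta>) = \<kappa> n (transpose b c \<circ> \<sigma>) \<beta> \<and>
      \<kappa> n \<sigma> (transpose a c \<circ> transpose a b \<circ> \<beta>) = \<kappa> n (transpose a b \<circ> transpose a c \<circ> \<sigma>) \<beta>"
    if "refines n \<beta> \<alpha>'" for \<beta>
    using fixing_\<kappa>(1-4)[OF fixing_refines[OF that]] conn_equiv[of \<beta>]
      ab_k[OF fixing_refines[OF that, unfolded fixing_def, THEN conjunct1]]
      ac_k[OF fixing_refines[OF that, unfolded fixing_def, THEN conjunct1]]
      bc_k[OF fixing_refines[OF that, unfolded fixing_def, THEN conjunct1]]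
      reg(3)[OF fixing_refines[OF that, unfolded fixing_def, THEN conjunct1]] by (auto split: if_splits)
  have id: "(\<Sum>\<beta> | refines n \<beta> \<alpha>'. whitney_term n \<sigma> \<alpha> \<beta>) =
      var_u ^ 0 * var_v ^ 0 * whitney n \<sigma> \<alpha>'"
    by (rule sum_whitney_term[OF \<sigma>_perm]; frule K; drule z_comp_refines; use A  in linarith)
  have ab: "(\<Sum>\<beta> | refines n \<beta> \<alpha>'. whitney_term n \<sigma> \<alpha> (transpose a b \<circ> \<beta>)) =
      var_u ^ 0 * var_v ^ 0 * whitney n (transpose a b \<circ> \<sigma>) \<alpha>'"
    by (rule sum_whitney_term[OF ab_v(1)]; frule K; drule z_comp_refines; use A ab_v(2) in linarith)
  have ac: "(\<Sum>\<beta> | refines n \<beta> \<alpha>'. whitney_term n \<sigma> \<alpha> (transpose a c \<circ> \<beta>)) =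
      var_u ^ 0 * var_v ^ 0 * whitney n (transpose a c \<circ> \<sigma>) \<alpha>'"
    by (rule sum_whitney_term[OF ac_v(1)]; frule K; drule z_comp_refines; use A ac_v(2) in linarith)
  have bc: "(\<Sum>\<beta> | refines n \<beta> \<alpha>'. whitney_term n \<sigma> \<alpha> (transpose b c \<circ> \<beta>)) =
      var_u ^ 0 * var_v ^ 0 * whitney n (transpose b c \<circ> \<sigma>) \<alpha>'"
    by (rule sum_whitney_term[OF bc_v(1)]; frule K; drule z_comp_refines; use A bc_v(2) in linarith)
  have comp: "(\<Sum>\<beta> | refines n \<beta> \<alpha>'. whitney_term n \<sigma> \<alpha> (transpose a c \<circ> transpose a b \<circ> \<beta>)) =
      var_u ^ 0 * var_v ^ 0 * whitney n (transpose a b \<circ> transpose a c \<circ> \<sigma>) \<alpha>'"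
    by (rule sum_whitney_term[OF reg(1)]; frule K; drule z_comp_refines; use A reg(2) in linarith)
  show ?thesis unfolding whitney_three_cycle id ab ac bc comp
    by (simp add: algebra_simps power2_eq_square)
qed

end

theorem theorem4p1:
  fixes n :: nat and \<sigma> \<alpha> \<alpha>' :: "nat \<Rightarrow> nat"
  assumes "hypermap n \<sigma> \<alpha>"
    and "is_three_cycle \<alpha> 1 2 3"
    and "\<alpha>' = \<alpha> \<circ> cycle_of_list [1, 3, 2]"
  shows
    "(double_loop \<sigma> 1 2 3 \<longrightarrow>
        whitney n \<sigma> \<alpha> = (1 + 3 * var_v + var_v ^ 2) * whitney n \<sigma> \<alpha>') \<and>
     (double_bridge n \<sigma> \<alpha> 1 2 3 \<longrightarrow>
        whitney n \<sigma> \<alpha> =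
          (1 + 3 * var_u + var_u ^ 2) * whitney n (transpose 1 2 \<circ> transpose 1 3 \<circ> \<sigma>) \<alpha>') \<and>
     (simple_loop n \<sigma> \<alpha> 1 2 3 \<and> same_cycle \<sigma> 1 2 \<longrightarrow>
        whitney n \<sigma> \<alpha> =
          (1 + var_v) * (whitney n (transpose 2 3 \<circ> \<sigma>) \<alpha>' + whitney n \<sigma> \<alpha>')
          + whitney n (transpose 1 3 \<circ> \<sigma>) \<alpha>') \<and>
     (simple_bridge n \<sigma> \<alpha> 1 2 3 \<and> \<kappa> n \<sigma> (\<alpha> \<circ> transpose 2 3) = \<kappa> n \<sigma> \<alpha> + 1 \<longrightarrow>
        whitney n \<sigma> \<alpha> =
          (1 + var_u) * (whitney n (transpose 2 3 \<circ> \<sigma>) \<alpha>'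
                         + whitney n (transpose 1 2 \<circ> transpose 1 3 \<circ> \<sigma>) \<alpha>')
          + whitney n (transpose 1 3 \<circ> \<sigma>) \<alpha>') \<and>
     (bridge_loop n \<sigma> \<alpha> 1 2 3 \<and> same_cycle \<sigma> 1 2 \<longrightarrow>
        whitney n \<sigma> \<alpha> =
          (1 + var_u) * (1 + var_v) * whitney n (transpose 2 3 \<circ> \<sigma>) \<alpha>'
          + whitney n (transpose 1 3 \<circ> \<sigma>) \<alpha>') \<and>
     (ordinary_regular n \<sigma> \<alpha> 1 2 3 \<longrightarrow>
        whitney n \<sigma> \<alpha> =
          whitney n \<sigma> \<alpha>' + whitney n (transpose 2 3 \<circ> \<sigma>) \<alpha>'
          + whitney n (transpose 1 2 \<circ> \<sigma>) \<alpha>'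
          + whitney n (transpose 1 2 \<circ> transpose 1 3 \<circ> \<sigma>) \<alpha>'
          + whitney n (transpose 1 3 \<circ> \<sigma>) \<alpha>')"
proof -
  have \<alpha>': "\<alpha>' = split_cycle \<alpha> 1 2 3" using assms(3) by (simp only: split_cycle_def)
  interpret hypermap_three_cycle n \<sigma> \<alpha> 1 2 3
    using assms(1,2) by unfold_locales (auto simp: hypermap_def hypermap_collection_def)
  show ?thesis
    unfolding \<alpha>'
    using whitney_double_loop whitney_double_bridge whitney_simple_loop whitney_simple_bridge
      whitney_bridge_loop whitney_ordinary_regular by blast
qed

end
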